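(* Along a sequence $M\to\infty$, let $N=2n$ with $n=n(M)\ge1$, let $K=K(M)$ satisfy $n+1\le K<M$, and suppose $NK/M\to0$. Let $O_M$ be a Haar distributed random orthogonal matrix in $O(M)$, let $S\subseteq\{1,\ldots,M\}$ with $|S|=N$ be deterministic or chosen independently of $O_M$, let $r>0$ and $\tau=\tanh r$. Put $B:=\tau\,O_MP_KO_M^{\mathsf T}$, where $P_K:=I_K\oplus 0_{M-K}$, let $B_S$ be the principal submatrix of $B$ indexed by $S$, and put $X_M:=\sqrt M\,O_{S,[K]}^{\mathsf T}\in\mathbb R^{K\times N}$, where $O_{S,[K]}$ is the submatrix of $O_M$ with rows indexed by $S$ and columns indexed by $[K]=\{1,\ldots,K\}$. Let $$\delta_{M,N,K}:=d_{\mathrm{TV}}\bigl(\mathcal L(X_M),\mathcal L(X)\bigr),$$ where $X\in\mathbb R^{K\times N}$ has independent standard normal entries. Then $B_S=\frac{\tau}{M}X_M^{\mathsf T}X_M$, and for every $\varepsilon\ge0$, $$\sup_{z\in\mathbb R}\mathbb P\left\{\left|\operatorname{haf}(B_S)-z\right|\le\varepsilon\left(\frac{\tau}{M}\right)^n\sigma_{K,n}\right\}\le\min\{1,B^{\mathbb R}_{K,n}\varepsilon\}+\delta_{M,N,K}.$$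
   Context: For a symmetric $2n\times2n$ matrix $T$, $\operatorname{haf}(T)=\sum_{\mathfrak m\in\mathcal M_{2n}}\prod_{\{i,j\}\in\mathfrak m}T_{ij}$, where $\mathcal M_{2n}$ is the set of perfect matchings of $\{1,\ldots,2n\}$ (the index set $S$ is identified with $\{1,\ldots,2n\}$ by any ordering). Total variation is $d_{\mathrm{TV}}(\mu,\nu)=\sup_A|\mu(A)-\nu(A)|$, and $\mathcal L(\cdot)$ denotes the law of a random matrix. For integers $n,k\ge1$, let $H_{k,n}=\operatorname{haf}(X^{\mathsf T}X)$ where $X\in\mathbb R^{k\times2n}$ has independent standard normal entries, and put $\sigma_{k,n}:=(\mathbb E H_{k,n}^2)^{1/2}$. For $d>1$ put $\gamma_d:=\mathbb E[(\chi_d^2)^{-1/2}]=2^{-1/2}\Gamma((d-1)/2)/\Gamma(d/2)$. For $k\ge n+1$, $$B^{\mathbb R}_{k,n}:=\sqrt{\frac2\pi}\,\sigma_{k,n}\left(\prod_{j=0}^{n-1}\gamma_{k-j}\right)\left(\prod_{r=2}^{n}\gamma_{2r-1}\right),$$ with empty products equal to one. *)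

theory Defs
  imports "HOL-Probability.Probability" "Jordan_Normal_Form.Matrix"
begin

(* Index sets are 0-based: {1,...,m} is rendered as {..<m}. *)

definition perfect_matchings :: "nat set \<Rightarrow> nat set set set" where
  "perfect_matchings V = {m. partition_on V m \<and> (\<forall>e\<in>m. card e = 2)}"

(* Only used for symmetric matrices, so the orientation (Min e, Max e) of the
   edge e is immaterial. *)
definition haf :: "real mat \<Rightarrow> real" where
  "haf T = (\<Sum>m\<in>perfect_matchings {..<dim_row T}. \<Prod>e\<in>m. T $$ (Min e, Max e))"

definition mat_borel :: "nat \<Rightarrow> nat \<Rightarrow> real mat measure" where
  "mat_borel k m = vimage_algebra (carrier_mat k m)
     (\<lambda>A. \<lambda>p\<in>{..<k} \<times> {..<m}. A $$ p) (Pi\<^sub>M ({..<k} \<times> {..<m}) (\<lambda>_. borel))"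

definition std_normal :: "real measure" where
  "std_normal = density lborel (\<lambda>x. ennreal (std_normal_density x))"

definition gauss_mat :: "nat \<Rightarrow> nat \<Rightarrow> real mat measure" where
  "gauss_mat k m = distr (Pi\<^sub>M ({..<k} \<times> {..<m}) (\<lambda>_. std_normal)) (mat_borel k m)
     (\<lambda>x. Matrix.mat k m x)"

(* Intended for measures on the same sigma-algebra. *)
definition tv_dist :: "'a measure \<Rightarrow> 'a measure \<Rightarrow> real" where
  "tv_dist \<mu> \<nu> = (SUP A\<in>sets \<mu>. \<bar>measure \<mu> A - measure \<nu> A\<bar>)"

definition orthogonal_group :: "nat \<Rightarrow> real mat set" where
  "orthogonal_group M = {Q \<in> carrier_mat M M. transpose_mat Q * Q = 1\<^sub>m M}"

definition orth_borel :: "nat \<Rightarrow> real mat measure" where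
  "orth_borel M = restrict_space (mat_borel M M) (orthogonal_group M)"

(* O(M) is compact, so a left-invariant probability measure is the Haar
   probability measure (and is also right-invariant). *)
definition haar_orthogonal :: "nat \<Rightarrow> real mat measure \<Rightarrow> bool" where
  "haar_orthogonal M \<mu> \<longleftrightarrow> prob_space \<mu> \<and> sets \<mu> = sets (orth_borel M) \<and>
     (\<forall>Q\<in>orthogonal_group M. distr \<mu> (orth_borel M) (\<lambda>A. Q * A) = \<mu>)"

definition proj_mat :: "nat \<Rightarrow> nat \<Rightarrow> real mat" where
  "proj_mat M K = diag_block_mat [1\<^sub>m K, 0\<^sub>m (M - K) (M - K)]"

definition \<sigma>_haf :: "nat \<Rightarrow> nat \<Rightarrow> real" where
  "\<sigma>_haf k n = sqrt (\<integral>X. (haf (transpose_mat X * X))\<^sup>2 \<partial>gauss_mat k (2 * n))"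

definition chi_square :: "nat \<Rightarrow> real measure" where
  "chi_square d = distr (Pi\<^sub>M {..<d} (\<lambda>_. std_normal)) borel (\<lambda>x. \<Sum>i<d. (x i)\<^sup>2)"

definition \<gamma>_chi :: "nat \<Rightarrow> real" where
  "\<gamma>_chi d = (\<integral>y. y powr (-1/2) \<partial>chi_square d)"

definition B_real :: "nat \<Rightarrow> nat \<Rightarrow> real" where
  "B_real k n = sqrt (2 / pi) * \<sigma>_haf k n * (\<Prod>j<n. \<gamma>_chi (k - j)) * (\<Prod>r=2..n. \<gamma>_chi (2 * r - 1))"

end

theory Submission
  imports Defs
begin

text \<open>
  Why the bound holds. The first claim is a computation with \<open>P\<^sub>K\<close>: the \<open>(a, b)\<close> entry of
  \<open>U P\<^sub>K U\<^sup>T\<close> is the inner product of the truncated rows \<open>a\<close> and \<open>b\<close> of \<open>U\<close>. Hence \<open>haf(B\<^sub>S)\<close> is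
  \<open>(\<tau>/M)\<^sup>n haf(X\<^sub>M\<^sup>T X\<^sub>M)\<close>, the event in question is \<open>X\<^sub>M \<in> A\<close> for a measurable set \<open>A\<close> of matrices,
  and by definition of total variation replacing \<open>X\<^sub>M\<close> by a Gaussian matrix costs at most \<open>\<delta>\<close>. What
  remains is anticoncentration of \<open>H = haf(X\<^sup>T X)\<close> for a Gaussian \<open>k \<times> 2n\<close> matrix \<open>X\<close>.

  By Levy's inversion formula an interval of length \<open>2h\<close> has probability at most
  \<open>(h/\<pi>) \<integral>|\<phi>(t)|dt\<close>, where \<open>\<phi>\<close> is the characteristic function of \<open>H\<close>
  (\<open>small_ball_le_char_integral\<close>). The heart of the proof is that \<open>\<phi>\<close> is dominated by the
  characteristic function of a product of independent variables: with \<open>\<rho>\<close> and \<open>s\<close> independent,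
  distributed as \<open>\<chi>\<^sub>k\<close> and \<open>\<chi>\<close> with \<open>2n - 1\<close> degrees of freedom, and \<open>\<phi>'\<close> belonging to a
  \<open>(k - 1) \<times> (2n - 2)\<close> matrix,
  \<open>|\<phi>(t)| \<le> E |\<phi>'(t \<rho> s)|\<close> (\<open>cf_step\<close>). Integrating over \<open>t\<close> and substituting turns the two factors
  into \<open>E(1/\<rho>) E(1/s) = \<gamma>\<^bsub>k\<^esub> \<gamma>\<^bsub>2n-1\<^esub>\<close>, and induction on \<open>n\<close> produces the product in the theorem
  (\<open>cf_L1_le\<close>), starting from \<open>n = 1\<close>, where \<open>H\<close> is a \<open>\<chi>\<^sub>k\<close> variable times a standard normal one.

  The comparison has two steps. First, fix one column; since both \<open>H\<close> and the law of the other columns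
  are invariant under rotations of \<open>R\<^sup>k\<close>, the column may be rotated into \<open>\<rho> e\<close> with a unit vector
  \<open>e\<close> (\<open>col_merge\<close>). Second, fix the coordinates \<open>g\<^sub>j\<close> of the other columns in direction \<open>e\<close>. As a
  function of two columns \<open>a, b\<close> the hafnian is a symmetric bilinear form, and Gaussian
  integration shows that the modulus of the characteristic function does not decrease when
  \<open>(g\<^sub>a, g\<^sub>b)\<close> is replaced by \<open>((g\<^sub>a\<^sup>2 + g\<^sub>b\<^sup>2)\<^bsup>1/2\<^esup>, 0)\<close> (\<open>merge_two_columns\<close>, \<open>row_merge\<close>). After finitely
  many such replacements all of \<open>g\<close> is concentrated in one column \<open>q\<close>, with length \<open>s\<close>. The column \<open>\<rho> e\<close> can
  then be matched with \<open>q\<close> only, so \<open>H = \<rho> s H'\<close> with \<open>H'\<close> the hafnian of the remaining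
  \<open>(k - 1) \<times> (2n - 2)\<close> Gaussian matrix (\<open>gram_haf_pivot\<close>).
\<close>

section \<open>Hafnians of Gram matrices\<close>

definition hafs :: "nat set \<Rightarrow> (nat \<Rightarrow> nat \<Rightarrow> real) \<Rightarrow> real" where
  "hafs V T = (\<Sum>m\<in>perfect_matchings V. \<Prod>e\<in>m. T (Min e) (Max e))"

lemma haf_eq_hafs: "haf A = hafs {..<dim_row A} (\<lambda>a b. A $$ (a, b))"
  by (simp add: haf_def hafs_def)

lemma hafs_empty [simp]: "hafs {} T = 1"
proof -
  have "perfect_matchings {} = {{}}"
    by (auto simp: perfect_matchings_def partition_on_empty)
  then show ?thesis by (simp add: hafs_def)
qed

lemma perfect_matchings_edge:
  assumes "m \<in> perfect_matchings V" "e \<in> m"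
  shows "e \<subseteq> V" "card e = 2"
  using assms by (auto simp: perfect_matchings_def partition_on_def)

lemma hafs_cong:
  assumes "\<And>a b. a \<in> V \<Longrightarrow> b \<in> V \<Longrightarrow> T a b = T' a b"
  shows "hafs V T = hafs V T'"
  unfolding hafs_def
proof (intro sum.cong prod.cong refl)
  fix m e assume m: "m \<in> perfect_matchings V" "e \<in> m"
  have "finite e" "e \<noteq> {}" using perfect_matchings_edge(2)[OF m] card_gt_0_iff[of e] by auto
  then have "Min e \<in> e" "Max e \<in> e" by auto
  then show "T (Min e) (Max e) = T' (Min e) (Max e)"
    using perfect_matchings_edge(1)[OF m] assms by blast
qed

lemma finite_perfect_matchings:
  assumes "finite V" shows "finite (perfect_matchings V)"
proof -
  have "perfect_matchings V \<subseteq> Pow (Pow V)"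
    by (auto simp: perfect_matchings_def partition_on_def)
  then show ?thesis using assms by (meson finite_Pow_iff finite_subset)
qed

lemma perfect_matchings_insert_edge:
  assumes "a \<in> V" "b \<in> V" "a \<noteq> b" "m \<in> perfect_matchings (V - {a, b})"
  shows "insert {a, b} m \<in> perfect_matchings V" "{a, b} \<notin> m"
proof -
  have m: "partition_on (V - {a, b}) m" "\<forall>e\<in>m. card e = 2"
    using assms(4) by (auto simp: perfect_matchings_def)
  then have "\<Union>m = V - {a, b}" by (simp add: partition_on_def)
  then have "disjnt {a, b} (\<Union>m)" by (auto simp: disjnt_def)
  then have "partition_on V (insert {a, b} m)"
    using partition_on_insert[of "{a, b}" m V] m(1) assms by auto
  then show "insert {a, b} m \<in> perfect_matchings V"
    using m(2) assms(3) by (auto simp: perfect_matchings_def)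
  show "{a, b} \<notin> m" using \<open>\<Union>m = V - {a, b}\<close> by auto
qed

lemma perfect_matchings_decomp:
  assumes "a \<in> V"
  shows "perfect_matchings V = (\<Union>b\<in>V - {a}. insert {a, b} ` perfect_matchings (V - {a, b}))"
proof (intro equalityI subsetI)
  fix m assume m: "m \<in> perfect_matchings V"
  then have p: "partition_on V m" and c: "\<forall>e\<in>m. card e = 2"
    by (auto simp: perfect_matchings_def)
  then obtain e where e: "e \<in> m" "a \<in> e" using assms by (auto simp: partition_on_def)
  moreover from e(1) c obtain x y where "e = {x, y}" "x \<noteq> y" by (metis card_2_iff)
  ultimately obtain b where b: "e = {a, b}" "b \<noteq> a" by auto
  have bV: "b \<in> V" using perfect_matchings_edge(1)[OF m e(1)] b by auto
  define m' where "m' = m - {e}"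
  have mm: "m = insert e m'" using e by (auto simp: m'_def)
  have dj: "disjnt e (\<Union>m')"
    using p e by (auto simp: m'_def partition_on_def disjoint_def disjnt_def)
  have "partition_on (V - e) m'"
    using partition_on_insert[OF dj, of V] p mm by simp
  then have "m' \<in> perfect_matchings (V - {a, b})"
    using c b mm by (auto simp: perfect_matchings_def)
  then show "m \<in> (\<Union>b\<in>V - {a}. insert {a, b} ` perfect_matchings (V - {a, b}))"
    using mm b bV by auto
next
  fix m assume "m \<in> (\<Union>b\<in>V - {a}. insert {a, b} ` perfect_matchings (V - {a, b}))"
  then show "m \<in> perfect_matchings V"
    using perfect_matchings_insert_edge(1)[OF assms] by auto
qed

text \<open>Sort the matchings by the partner \<open>b\<close> of a fixed vertex \<open>a\<close>. Symmetry of \<open>T\<close> removes the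
  orientation \<open>(Min e, Max e)\<close> used in the definition.\<close>

lemma hafs_rec:
  assumes fin: "finite V" and a: "a \<in> V" and sym: "\<And>u v. T u v = T v u"
  shows "hafs V T = (\<Sum>b\<in>V - {a}. T a b * hafs (V - {a, b}) T)"
proof -
  have dj: "insert {a, b} ` perfect_matchings (V - {a, b}) \<inter>
      insert {a, b'} ` perfect_matchings (V - {a, b'}) = {}"
    if "b \<in> V - {a}" "b' \<in> V - {a}" "b \<noteq> b'" for b b'
  proof (rule ccontr)
    assume "\<not> ?thesis"
    then obtain m m' where m: "m \<in> perfect_matchings (V - {a, b})"
        "m' \<in> perfect_matchings (V - {a, b'})" "insert {a, b} m = insert {a, b'} m'" by auto
    then have "{a, b} \<in> m'" using that by (metis doubleton_eq_iff insertE insertI1)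
    with perfect_matchings_edge(1)[OF m(2)] show False by auto
  qed
  have "hafs V T = (\<Sum>b\<in>V - {a}. \<Sum>m\<in>insert {a, b} ` perfect_matchings (V - {a, b}).
      \<Prod>e\<in>m. T (Min e) (Max e))"
    unfolding hafs_def perfect_matchings_decomp[OF a]
    using fin finite_perfect_matchings dj by (intro sum.UNION_disjoint) auto
  also have "\<dots> = (\<Sum>b\<in>V - {a}. T a b * hafs (V - {a, b}) T)"
  proof (rule sum.cong[OF refl])
    fix b assume b: "b \<in> V - {a}"
    have nin: "{a, b} \<notin> m" if "m \<in> perfect_matchings (V - {a, b})" for m
      using perfect_matchings_insert_edge(2)[OF a _ _ that] b by auto
    have inj: "inj_on (insert {a, b}) (perfect_matchings (V - {a, b}))"
      by (rule inj_onI) (metis nin insert_ident)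
    have Tab: "T (Min {a, b}) (Max {a, b}) = T a b"
      using b sym[of a b] by (cases a b rule: linorder_cases) auto
    have "(\<Sum>m\<in>insert {a, b} ` perfect_matchings (V - {a, b}). \<Prod>e\<in>m. T (Min e) (Max e))
      = (\<Sum>m\<in>perfect_matchings (V - {a, b}). \<Prod>e\<in>insert {a, b} m. T (Min e) (Max e))"
      by (simp add: sum.reindex[OF inj])
    also have "\<dots> = (\<Sum>m\<in>perfect_matchings (V - {a, b}). T a b * (\<Prod>e\<in>m. T (Min e) (Max e)))"
    proof (rule sum.cong[OF refl])
      fix m assume m: "m \<in> perfect_matchings (V - {a, b})"
      have "finite m" using m fin
        by (auto simp: perfect_matchings_def partition_on_def intro: finite_UnionD)
      then show "(\<Prod>e\<in>insert {a, b} m. T (Min e) (Max e)) = T a b * (\<Prod>e\<in>m. T (Min e) (Max e))"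
        using nin[OF m] Tab by simp
    qed
    finally show "(\<Sum>m\<in>insert {a, b} ` perfect_matchings (V - {a, b}). \<Prod>e\<in>m. T (Min e) (Max e))
      = T a b * hafs (V - {a, b}) T" by (simp add: hafs_def sum_distrib_left)
  qed
  finally show ?thesis .
qed

text \<open>Two vertices are either matched to each other or to two further vertices \<open>u \<noteq> v\<close>. This exhibits
  the dependence of the hafnian on two columns.\<close>

lemma hafs_two_columns:
  assumes fin: "finite V" and ab: "a \<in> V" "b \<in> V" "a \<noteq> b" and sym: "\<And>u v. T u v = T v u"
  shows "hafs V T = T a b * hafs (V - {a, b}) T +
    (\<Sum>u\<in>V - {a, b}. \<Sum>v\<in>V - {a, b} - {u}. T a u * T b v * hafs (V - {a, b} - {u, v}) T)"
proof -
  have "hafs V T = T a b * hafs (V - {a, b}) T +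
      (\<Sum>u\<in>V - {a} - {b}. T a u * hafs (V - {a, u}) T)"
    unfolding hafs_rec[OF fin ab(1) sym] using ab fin by (subst sum.remove[of _ b]) auto
  also have "(\<Sum>u\<in>V - {a} - {b}. T a u * hafs (V - {a, u}) T) =
    (\<Sum>u\<in>V - {a, b}. \<Sum>v\<in>V - {a, b} - {u}. T a u * T b v * hafs (V - {a, b} - {u, v}) T)"
  proof (rule sum.cong)
    fix u assume u: "u \<in> V - {a, b}"
    have "hafs (V - {a, u}) T = (\<Sum>v\<in>V - {a, u} - {b}. T b v * hafs (V - {a, u} - {b, v}) T)"
      using fin ab u by (intro hafs_rec sym) auto
    also have "\<dots> = (\<Sum>v\<in>V - {a, b} - {u}. T b v * hafs (V - {a, b} - {u, v}) T)"
      by (intro sum.cong arg_cong2[where f="(*)"] arg_cong2[where f=hafs]) auto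
    finally show "T a u * hafs (V - {a, u}) T =
        (\<Sum>v\<in>V - {a, b} - {u}. T a u * T b v * hafs (V - {a, b} - {u, v}) T)"
      by (simp add: sum_distrib_left mult.assoc)
  qed auto
  finally show ?thesis .
qed

lemma hafs_scale:
  assumes "finite V" "card V = 2 * n"
  shows "hafs V (\<lambda>a b. c * T a b) = c ^ n * hafs V T"
  unfolding hafs_def sum_distrib_left
proof (rule sum.cong[OF refl])
  fix m assume m: "m \<in> perfect_matchings V"
  then have "card V = (\<Sum>e\<in>m. card e)"
    by (metis (mono_tags, lifting) mem_Collect_eq perfect_matchings_def product_partition
        assms(1) finite_subset perfect_matchings_edge(1) m)
  also have "\<dots> = 2 * card m" using perfect_matchings_edge(2)[OF m] by simp
  finally have "card m = n" using assms by simp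
  then show "(\<Prod>e\<in>m. c * T (Min e) (Max e)) = c ^ n * (\<Prod>e\<in>m. T (Min e) (Max e))"
    by (simp add: prod.distrib)
qed

text \<open>A real matrix is handled as a function on index pairs, so that rows and columns can be
  removed by shrinking \<open>R\<close> and \<open>V\<close> while the function, and the measure it is drawn from, stay the same.\<close>

definition gram :: "nat set \<Rightarrow> (nat \<times> nat \<Rightarrow> real) \<Rightarrow> nat \<Rightarrow> nat \<Rightarrow> real" where
  "gram R X a b = (\<Sum>i\<in>R. X (i, a) * X (i, b))"

definition gram_haf :: "nat set \<Rightarrow> nat set \<Rightarrow> (nat \<times> nat \<Rightarrow> real) \<Rightarrow> real" where
  "gram_haf R V X = hafs V (gram R X)"

lemma gram_sym: "gram R X a b = gram R X b a"
  by (simp add: gram_def mult.commute)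

lemma gram_haf_cong:
  assumes "\<And>i j. i \<in> R \<Longrightarrow> j \<in> V \<Longrightarrow> X (i, j) = Y (i, j)"
  shows "gram_haf R V X = gram_haf R V Y"
  unfolding gram_haf_def using assms by (intro hafs_cong) (auto simp: gram_def intro!: sum.cong)

text \<open>The coefficient matrix \<open>A\<close> is chosen from \<open>W\<close> alone, so it serves for all \<open>X\<close> that agree with
  \<open>W\<close> outside the two columns; it is symmetric because exchanging the partners \<open>u\<close> and \<open>v\<close> permutes the
  matchings.\<close>

lemma gram_haf_bilinear:
  assumes fin: "finite V" "finite R" and ab: "a \<in> V" "b \<in> V" "a \<noteq> b"
  obtains A :: "nat \<Rightarrow> nat \<Rightarrow> real" where
    "\<And>i j. A i j = A j i"
    "\<And>X. (\<And>i j. i \<in> R \<Longrightarrow> j \<in> V - {a, b} \<Longrightarrow> X (i, j) = W (i, j)) \<Longrightarrow>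
      gram_haf R V X = (\<Sum>i\<in>R. \<Sum>j\<in>R. A i j * (X (i, a) * X (j, b)))"
proof
  let ?V = "V - {a, b}"
  define h where "h u v = hafs (?V - {u, v}) (gram R W)" for u v
  define A where "A i j = (if i = j then hafs ?V (gram R W) else 0) +
      (\<Sum>u\<in>?V. \<Sum>v\<in>?V. if u = v then 0 else W (i, u) * W (j, v) * h u v)" for i j
  have hsym: "h u v = h v u" for u v by (simp add: h_def insert_commute)
  show "A i j = A j i" for i j
  proof -
    have "(\<Sum>u\<in>?V. \<Sum>v\<in>?V. if u = v then 0 else W (i, u) * W (j, v) * h u v)
      = (\<Sum>v\<in>?V. \<Sum>u\<in>?V. if u = v then 0 else W (i, u) * W (j, v) * h u v)" by (rule sum.swap)
    also have "\<dots> = (\<Sum>u\<in>?V. \<Sum>v\<in>?V. if u = v then 0 else W (j, u) * W (i, v) * h u v)"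
      by (intro sum.cong refl) (auto simp: hsym)
    finally show ?thesis by (simp add: A_def)
  qed
  fix X assume X: "\<And>i j. i \<in> R \<Longrightarrow> j \<in> ?V \<Longrightarrow> X (i, j) = W (i, j)"
  have hX: "hafs U (gram R X) = hafs U (gram R W)" if "U \<subseteq> ?V" for U
    unfolding gram_def using that X
    by (intro hafs_cong sum.cong arg_cong2[where f="(*)"] refl) blast+
  have "gram_haf R V X = gram R X a b * hafs ?V (gram R W) +
    (\<Sum>u\<in>?V. \<Sum>v\<in>?V - {u}. gram R X a u * gram R X b v * h u v)"
    unfolding gram_haf_def hafs_two_columns[OF fin(1) ab gram_sym] h_def
    by (intro arg_cong2[where f="(+)"] arg_cong2[where f="(*)"] sum.cong refl hX) auto
  also have "(\<Sum>u\<in>?V. \<Sum>v\<in>?V - {u}. gram R X a u * gram R X b v * h u v) =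
    (\<Sum>u\<in>?V. \<Sum>v\<in>?V. if u = v then 0 else gram R X a u * gram R X b v * h u v)"
    using fin by (intro sum.cong refl sum.mono_neutral_cong_left) auto
  also have "\<dots> = (\<Sum>u\<in>?V. \<Sum>v\<in>?V. \<Sum>i\<in>R. \<Sum>j\<in>R.
      (if u = v then 0 else W (i, u) * W (j, v) * h u v) * (X (i, a) * X (j, b)))"
  proof (intro sum.cong refl)
    fix u v assume uv: "u \<in> ?V" "v \<in> ?V"
    have "gram R X a u * gram R X b v =
      (\<Sum>i\<in>R. \<Sum>j\<in>R. W (i, u) * W (j, v) * (X (i, a) * X (j, b)))"
      unfolding gram_def sum_product using uv X by (intro sum.cong refl) auto
    then show "(if u = v then 0 else gram R X a u * gram R X b v * h u v) =
       (\<Sum>i\<in>R. \<Sum>j\<in>R. (if u = v then 0 else W (i, u) * W (j, v) * h u v) * (X (i, a) * X (j, b)))"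
      by (simp add: sum_distrib_left mult_ac)
  qed
  also have "\<dots> = (\<Sum>i\<in>R. \<Sum>j\<in>R. \<Sum>u\<in>?V. \<Sum>v\<in>?V.
      (if u = v then 0 else W (i, u) * W (j, v) * h u v) * (X (i, a) * X (j, b)))"
    by (simp only: sum.swap[where A="V - {a, b}" and B=R])
  also have "gram R X a b * hafs ?V (gram R W) =
    (\<Sum>i\<in>R. \<Sum>j\<in>R. (if i = j then hafs ?V (gram R W) else 0) * (X (i, a) * X (j, b)))"
  proof -
    have "(\<Sum>j\<in>R. (if i = j then hafs ?V (gram R W) else 0) * (X (i, a) * X (j, b))) =
        X (i, a) * X (i, b) * hafs ?V (gram R W)" if "i \<in> R" for i
      using fin that by (simp add: if_distrib[of "\<lambda>x. x * _"] sum.delta' cong: if_cong)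
    then show ?thesis by (simp add: gram_def sum_distrib_right)
  qed
  finally show "gram_haf R V X = (\<Sum>i\<in>R. \<Sum>j\<in>R. A i j * (X (i, a) * X (j, b)))"
    by (simp add: A_def sum.distrib distrib_right sum_distrib_right)
qed

text \<open>If column \<open>p\<close> is a multiple of the unit vector \<open>e\<close> and only column \<open>q\<close> has a component along
  \<open>e\<close>, then \<open>p\<close> is orthogonal to all columns but \<open>q\<close>, and every contributing matching pairs \<open>p\<close> with
  \<open>q\<close>.\<close>

lemma gram_haf_pivot:
  assumes fin: "finite V" "finite R" and e: "e \<in> R" and pq: "p \<in> V" "q \<in> V" "p \<noteq> q"
    and p0: "\<And>i. i \<in> R - {e} \<Longrightarrow> X (i, p) = 0" and e0: "\<And>j. j \<in> V - {p, q} \<Longrightarrow> X (e, j) = 0"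
  shows "gram_haf R V X = X (e, p) * X (e, q) * gram_haf (R - {e}) (V - {p, q}) X"
proof -
  have g: "gram R X p b = X (e, p) * X (e, b)" for b
    unfolding gram_def using fin e p0 by (subst sum.remove[of _ e]) auto
  have "gram_haf R V X = (\<Sum>b\<in>V - {p}. gram R X p b * hafs (V - {p, b}) (gram R X))"
    unfolding gram_haf_def by (intro hafs_rec fin pq gram_sym)
  also have "\<dots> = (\<Sum>b\<in>V - {p}. if b = q then gram R X p q * hafs (V - {p, q}) (gram R X) else 0)"
    using e0 by (intro sum.cong) (auto simp: g)
  also have "\<dots> = X (e, p) * X (e, q) * hafs (V - {p, q}) (gram R X)"
    using fin pq by (simp add: g)
  also have "hafs (V - {p, q}) (gram R X) = hafs (V - {p, q}) (gram (R - {e}) X)"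
  proof (intro hafs_cong)
    fix a b assume "a \<in> V - {p, q}" "b \<in> V - {p, q}"
    then show "gram R X a b = gram (R - {e}) X a b"
      unfolding gram_def using fin e e0 by (subst sum.remove[of _ e]) auto
  qed
  finally show ?thesis by (simp add: gram_haf_def)
qed

section \<open>Rotation invariance of Gaussian vectors\<close>

abbreviation gauss :: "'i set \<Rightarrow> ('i \<Rightarrow> real) measure" where
  "gauss I \<equiv> Pi\<^sub>M I (\<lambda>_. std_normal)"

lemma prob_space_std_normal: "prob_space std_normal"
  unfolding std_normal_def by (rule prob_space_normal_density) simp

interpretation std_normal: prob_space std_normal
  by (rule prob_space_std_normal)

interpretation gauss: product_sigma_finite "\<lambda>_. std_normal" ..

lemma sets_std_normal [simp, measurable_cong]: "sets std_normal = sets borel"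
  by (simp add: std_normal_def)

lemma space_std_normal [simp]: "space std_normal = UNIV"
  by (simp add: std_normal_def)

lemma prob_space_gauss: "prob_space (gauss I)"
  by (intro prob_space_PiM prob_space_std_normal)

lemma gauss_component: "i \<in> I \<Longrightarrow> (\<lambda>X. X i) \<in> borel_measurable (gauss I)"
  using measurable_component_singleton[of i I "\<lambda>_. std_normal"] by simp

text \<open>Integrate out one variable at a time: a rotation with \<open>c \<noteq> 0\<close> is a composition of two
  one-dimensional affine substitutions, with factors \<open>|c|\<close> and \<open>1/|c|\<close>. For \<open>c = 0\<close> it exchanges the
  variables up to signs.\<close>

lemma lborel_rotation:
  fixes g :: "real \<times> real \<Rightarrow> ennreal"
  assumes [measurable]: "g \<in> borel_measurable (borel \<Otimes>\<^sub>M borel)" and cs: "c\<^sup>2 + s\<^sup>2 = 1"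
  shows "(\<integral>\<^sup>+x. \<integral>\<^sup>+y. g (c * x + s * y, c * y - s * x) \<partial>lborel \<partial>lborel) =
    (\<integral>\<^sup>+x. \<integral>\<^sup>+y. g (x, y) \<partial>lborel \<partial>lborel)" (is "?L = ?R")
proof (cases "c = 0")
  case True
  then have s: "\<bar>s\<bar> = 1" using cs by (auto simp: power2_eq_1_iff)
  then have s0: "s \<noteq> 0" by auto
  have "?L = (\<integral>\<^sup>+x. \<integral>\<^sup>+u. g (u, - s * x) \<partial>lborel \<partial>lborel)"
  proof (rule nn_integral_cong)
    fix x show "(\<integral>\<^sup>+y. g (c * x + s * y, c * y - s * x) \<partial>lborel) = (\<integral>\<^sup>+u. g (u, - s * x) \<partial>lborel)"
      using s nn_integral_real_affine[of "\<lambda>u. g (u, - s * x)" s 0] s0 True by simp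
  qed
  also have "\<dots> = (\<integral>\<^sup>+u. \<integral>\<^sup>+x. g (u, - s * x) \<partial>lborel \<partial>lborel)"
    by (rule lborel_pair.Fubini') measurable
  also have "\<dots> = ?R"
  proof (rule nn_integral_cong)
    fix u show "(\<integral>\<^sup>+x. g (u, - s * x) \<partial>lborel) = (\<integral>\<^sup>+x. g (u, x) \<partial>lborel)"
      using s nn_integral_real_affine[of "\<lambda>x. g (u, x)" "- s" 0] s0 by simp
  qed
  finally show ?thesis .
next
  case False
  have "ennreal \<bar>c\<bar> * ?L = ennreal \<bar>c\<bar> * (\<integral>\<^sup>+y. \<integral>\<^sup>+x. g (c * x + s * y, c * y - s * x) \<partial>lborel \<partial>lborel)"
    by (rule arg_cong[where f="(*) _"], rule lborel_pair.Fubini') measurable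
  also have "\<dots> = (\<integral>\<^sup>+y. ennreal \<bar>c\<bar> * (\<integral>\<^sup>+x. g (c * x + s * y, c * y - s * x) \<partial>lborel) \<partial>lborel)"
    by (rule nn_integral_cmult[symmetric]) measurable
  also have "\<dots> = (\<integral>\<^sup>+y. \<integral>\<^sup>+u. g (u, (y - s * u) / c) \<partial>lborel \<partial>lborel)"
  proof (rule nn_integral_cong)
    fix y
    have "(y - s * (s * y + c * x)) / c = c * y - s * x" for x
    proof -
      have "y - s * (s * y + c * x) = (c\<^sup>2 + s\<^sup>2) * y - s\<^sup>2 * y - s * c * x"
        unfolding cs by (simp add: algebra_simps power2_eq_square)
      also have "\<dots> = c * (c * y - s * x)" by (simp add: algebra_simps power2_eq_square)
      finally show ?thesis using False by simp
    qed
    then show "ennreal \<bar>c\<bar> * (\<integral>\<^sup>+x. g (c * x + s * y, c * y - s * x) \<partial>lborel) =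
        (\<integral>\<^sup>+u. g (u, (y - s * u) / c) \<partial>lborel)"
      using nn_integral_real_affine[of "\<lambda>u. g (u, (y - s * u) / c)" c "s * y"] False
      by (simp add: add.commute)
  qed
  also have "\<dots> = (\<integral>\<^sup>+u. \<integral>\<^sup>+y. g (u, (y - s * u) / c) \<partial>lborel \<partial>lborel)"
    by (rule lborel_pair.Fubini') measurable
  also have "\<dots> = (\<integral>\<^sup>+u. ennreal \<bar>c\<bar> * (\<integral>\<^sup>+v. g (u, v) \<partial>lborel) \<partial>lborel)"
  proof (rule nn_integral_cong)
    fix u show "(\<integral>\<^sup>+y. g (u, (y - s * u) / c) \<partial>lborel) = ennreal \<bar>c\<bar> * (\<integral>\<^sup>+v. g (u, v) \<partial>lborel)"
      using nn_integral_real_affine[of "\<lambda>y. g (u, (y - s * u) / c)" c "s * u"] False by simp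
  qed
  also have "\<dots> = ennreal \<bar>c\<bar> * ?R"
    by (rule nn_integral_cmult) measurable
  finally show ?thesis using False
    by (simp add: ennreal_mult_cancel_left)
qed

lemma nn_integral_std_normal_pair:
  fixes h :: "real \<times> real \<Rightarrow> ennreal"
  assumes [measurable]: "h \<in> borel_measurable (borel \<Otimes>\<^sub>M borel)"
  shows "(\<integral>\<^sup>+x. \<integral>\<^sup>+y. h (x, y) \<partial>std_normal \<partial>std_normal) =
    (\<integral>\<^sup>+x. \<integral>\<^sup>+y. ennreal (std_normal_density x * std_normal_density y) * h (x, y) \<partial>lborel \<partial>lborel)"
proof -
  have inner: "(\<integral>\<^sup>+y. h (x, y) \<partial>std_normal) =
      (\<integral>\<^sup>+y. ennreal (std_normal_density y) * h (x, y) \<partial>lborel)" for x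
    unfolding std_normal_def by (rule nn_integral_density) measurable
  have "(\<integral>\<^sup>+x. \<integral>\<^sup>+y. h (x, y) \<partial>std_normal \<partial>std_normal) =
      (\<integral>\<^sup>+x. ennreal (std_normal_density x) * (\<integral>\<^sup>+y. ennreal (std_normal_density y) * h (x, y) \<partial>lborel) \<partial>lborel)"
    unfolding inner unfolding std_normal_def by (rule nn_integral_density) measurable
  also have "\<dots> = (\<integral>\<^sup>+x. \<integral>\<^sup>+y. ennreal (std_normal_density x * std_normal_density y) * h (x, y) \<partial>lborel \<partial>lborel)"
  proof (rule nn_integral_cong)
    fix x
    have "(\<lambda>y. ennreal (std_normal_density y) * h (x, y)) \<in> borel_measurable lborel" by measurable
    from nn_integral_cmult[OF this, of "ennreal (std_normal_density x)"]
    show "ennreal (std_normal_density x) * (\<integral>\<^sup>+y. ennreal (std_normal_density y) * h (x, y) \<partial>lborel) =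
        (\<integral>\<^sup>+y. ennreal (std_normal_density x * std_normal_density y) * h (x, y) \<partial>lborel)"
      by (simp add: ennreal_mult mult.assoc)
  qed
  finally show ?thesis .
qed

lemma std_normal_rotation:
  fixes f :: "real \<times> real \<Rightarrow> ennreal"
  assumes [measurable]: "f \<in> borel_measurable (borel \<Otimes>\<^sub>M borel)" and cs: "c\<^sup>2 + s\<^sup>2 = 1"
  shows "(\<integral>\<^sup>+x. \<integral>\<^sup>+y. f (c * x + s * y, c * y - s * x) \<partial>std_normal \<partial>std_normal) =
    (\<integral>\<^sup>+x. \<integral>\<^sup>+y. f (x, y) \<partial>std_normal \<partial>std_normal)"
proof -
  let ?g = "\<lambda>(x, y). ennreal (std_normal_density x * std_normal_density y) * f (x, y)"
  have rot: "std_normal_density (c * x + s * y) * std_normal_density (c * y - s * x) =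
      std_normal_density x * std_normal_density y" for x y
  proof -
    have "(c * x + s * y)\<^sup>2 + (c * y - s * x)\<^sup>2 = (c\<^sup>2 + s\<^sup>2) * (x\<^sup>2 + y\<^sup>2)"
      by (simp add: power2_eq_square algebra_simps)
    then have "- (c * x + s * y)\<^sup>2 / 2 + - (c * y - s * x)\<^sup>2 / 2 = - x\<^sup>2 / 2 + - y\<^sup>2 / 2"
      using cs by (simp add: field_simps)
    then show ?thesis
      by (simp add: std_normal_density_def exp_add[symmetric])
  qed
  have "(\<integral>\<^sup>+x. \<integral>\<^sup>+y. f (c * x + s * y, c * y - s * x) \<partial>std_normal \<partial>std_normal) =
     (\<integral>\<^sup>+x. \<integral>\<^sup>+y. ?g (c * x + s * y, c * y - s * x) \<partial>lborel \<partial>lborel)"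
  proof -
    have "(\<lambda>p. f (c * fst p + s * snd p, c * snd p - s * fst p)) \<in> borel_measurable (borel \<Otimes>\<^sub>M borel)"
      by measurable
    from nn_integral_std_normal_pair[OF this] show ?thesis by (simp only: rot prod.case fst_conv snd_conv)
  qed
  also have "\<dots> = (\<integral>\<^sup>+x. \<integral>\<^sup>+y. ?g (x, y) \<partial>lborel \<partial>lborel)"
    by (rule lborel_rotation[OF _ cs]) measurable
  also have "\<dots> = (\<integral>\<^sup>+x. \<integral>\<^sup>+y. f (x, y) \<partial>std_normal \<partial>std_normal)"
    using nn_integral_std_normal_pair[of f] by simp
  finally show ?thesis .
qed

text \<open>Conditioning on part of the coordinates is expressed by drawing the coordinates in \<open>J\<close> from an
  independent copy; this keeps a single measure space throughout.\<close>

definition resample :: "'i set \<Rightarrow> ('i \<Rightarrow> real) \<Rightarrow> ('i \<Rightarrow> real) \<Rightarrow> 'i \<Rightarrow> real" where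
  "resample J Z X = (\<lambda>i. if i \<in> J then Z i else X i)"

lemma resample_measurable:
  "(\<lambda>(Z, X). resample J Z X) \<in> gauss I \<Otimes>\<^sub>M gauss I \<rightarrow>\<^sub>M gauss I"
  unfolding resample_def case_prod_beta'
  by (rule measurable_PiM_single') (auto simp: space_pair_measure space_PiM PiE_iff extensional_def)

lemma distr_resample:
  assumes fin: "finite I"
  shows "distr (gauss I \<Otimes>\<^sub>M gauss I) (gauss I) (\<lambda>(Z, X). resample J Z X) = gauss I"
proof (rule gauss.PiM_eqI[OF fin])
  fix A assume A: "\<And>i. i \<in> I \<Longrightarrow> A i \<in> sets std_normal"
  interpret G: prob_space "gauss I" by (rule prob_space_gauss)
  \<comment> \<open>The preimage of a box is a product of two boxes, each unconstrained where the other is not.\<close>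
  let ?A1 = "\<lambda>i. if i \<in> J then A i else UNIV" and ?A2 = "\<lambda>i. if i \<in> J then UNIV else A i"
  have m: "Pi\<^sub>E I A \<in> sets (gauss I)" using fin A by (intro sets_PiM_I_finite) auto
  have "(\<lambda>(Z, X). resample J Z X) -` Pi\<^sub>E I A \<inter> space (gauss I \<Otimes>\<^sub>M gauss I) =
      Pi\<^sub>E I ?A1 \<times> Pi\<^sub>E I ?A2"
    by (auto simp: space_pair_measure space_PiM PiE_iff resample_def extensional_def split: if_splits)
  then have "emeasure (distr (gauss I \<Otimes>\<^sub>M gauss I) (gauss I) (\<lambda>(Z, X). resample J Z X)) (Pi\<^sub>E I A) =
      emeasure (gauss I) (Pi\<^sub>E I ?A1) * emeasure (gauss I) (Pi\<^sub>E I ?A2)"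
    using A fin by (subst emeasure_distr[OF resample_measurable m], simp, intro G.emeasure_pair_measure_Times)
      (auto intro!: sets_PiM_I_finite)
  also have "\<dots> = (\<Prod>i\<in>I. emeasure std_normal (?A1 i) * emeasure std_normal (?A2 i))"
    using A fin by (subst (1 2) gauss.emeasure_PiM) (auto simp: prod.distrib)
  also have "\<dots> = (\<Prod>i\<in>I. emeasure std_normal (A i))"
    using std_normal.emeasure_space_1 by (intro prod.cong) auto
  finally show "emeasure (distr (gauss I \<Otimes>\<^sub>M gauss I) (gauss I) (\<lambda>(Z, X). resample J Z X)) (Pi\<^sub>E I A) =
    (\<Prod>i\<in>I. emeasure std_normal (A i))" .
qed simp

text \<open>Simultaneous plane rotations of the disjoint coordinate pairs \<open>(i, \<sigma> i)\<close>, \<open>i \<in> D\<close>, for an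
  involution \<open>\<sigma>\<close>. Rotating two columns or two rows of a matrix are instances.\<close>

definition givens :: "real \<Rightarrow> real \<Rightarrow> ('i \<Rightarrow> 'i) \<Rightarrow> 'i set \<Rightarrow> ('i \<Rightarrow> real) \<Rightarrow> 'i \<Rightarrow> real" where
  "givens c s \<sigma> D X = (\<lambda>i. if i \<in> D then c * X i + s * X (\<sigma> i)
     else if \<sigma> i \<in> D then c * X i - s * X (\<sigma> i) else X i)"

lemma givens_measurable:
  assumes "\<And>i. \<sigma> (\<sigma> i) = i" "D \<subseteq> I" "\<sigma> ` D \<subseteq> I"
  shows "givens c s \<sigma> D \<in> gauss I \<rightarrow>\<^sub>M gauss I"
proof -
  have out: "i \<in> I" if "\<sigma> i \<in> D" for i using assms(1)[of i] assms(3) that by force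
  have "(\<lambda>X. givens c s \<sigma> D X) \<in> gauss I \<rightarrow>\<^sub>M gauss I"
  proof (rule measurable_PiM_single')
    show "(\<lambda>X i. givens c s \<sigma> D X i) \<in> space (gauss I) \<rightarrow> I \<rightarrow>\<^sub>E space std_normal"
      using assms(2) out by (auto simp: givens_def space_PiM PiE_iff extensional_def)
    fix i assume i: "i \<in> I"
    have s: "i \<in> D \<Longrightarrow> \<sigma> i \<in> I" "\<sigma> i \<in> D \<Longrightarrow> \<sigma> i \<in> I" using assms by auto
    show "(\<lambda>X. givens c s \<sigma> D X i) \<in> gauss I \<rightarrow>\<^sub>M std_normal"
      unfolding givens_def using i s
      by (cases "i \<in> D"; cases "\<sigma> i \<in> D") (auto simp: measurable_cong_sets[OF refl sets_std_normal])
  qed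
  then show ?thesis .
qed

lemma distr_givens_single:
  assumes fin: "finite I" and cs: "c\<^sup>2 + s\<^sup>2 = 1" and inv: "\<And>i. \<sigma> (\<sigma> i) = i"
    and d: "d \<in> I" "\<sigma> d \<in> I" "\<sigma> d \<noteq> d"
  shows "distr (gauss I) (gauss I) (givens c s \<sigma> {d}) = gauss I"
proof (rule measure_eqI)
  have mG: "givens c s \<sigma> {d} \<in> gauss I \<rightarrow>\<^sub>M gauss I"
    using d inv by (intro givens_measurable) auto
  fix A assume "A \<in> sets (distr (gauss I) (gauss I) (givens c s \<sigma> {d}))"
  then have A [measurable]: "A \<in> sets (gauss I)" by simp
  let ?I = "I - {d, \<sigma> d}"
  have I: "I = insert (\<sigma> d) (insert d ?I)" using d by auto
  have split: "integral\<^sup>N (gauss I) f =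
      (\<integral>\<^sup>+X. \<integral>\<^sup>+x. \<integral>\<^sup>+y. f (X(d := x, \<sigma> d := y)) \<partial>std_normal \<partial>std_normal \<partial>gauss ?I)"
    if f: "f \<in> borel_measurable (gauss I)" for f :: "_ \<Rightarrow> ennreal"
  proof -
    have f': "f \<in> borel_measurable (gauss (insert (\<sigma> d) (insert d ?I)))" using f I by simp
    have 1: "integral\<^sup>N (gauss I) f =
        (\<integral>\<^sup>+X. \<integral>\<^sup>+y. f (X(\<sigma> d := y)) \<partial>std_normal \<partial>gauss (insert d ?I))"
      by (subst I, rule gauss.product_nn_integral_insert) (use fin d f' in auto)
    have "(\<lambda>(X, y). f (X(\<sigma> d := y))) \<in> borel_measurable (gauss (insert d ?I) \<Otimes>\<^sub>M std_normal)"
      unfolding case_prod_beta'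
      by (rule measurable_compose[OF _ f'], rule measurable_fun_upd[where J="insert d ?I"]) auto
    then have "(\<lambda>X. \<integral>\<^sup>+y. f (X(\<sigma> d := y)) \<partial>std_normal) \<in> borel_measurable (gauss (insert d ?I))"
      using std_normal.borel_measurable_nn_integral by simp
    then show ?thesis
      unfolding 1 using fin d by (intro gauss.product_nn_integral_insert) auto
  qed
  have ind: "indicator A \<in> borel_measurable (gauss I)" by simp
  have "emeasure (distr (gauss I) (gauss I) (givens c s \<sigma> {d})) A =
      (\<integral>\<^sup>+X. indicator A (givens c s \<sigma> {d} X) \<partial>gauss I)"
    by (subst nn_integral_indicator[symmetric], simp, subst nn_integral_distr[OF mG]) auto
  also have "\<dots> = (\<integral>\<^sup>+X. \<integral>\<^sup>+x. \<integral>\<^sup>+y. indicator A (givens c s \<sigma> {d} (X(d := x, \<sigma> d := y)))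
      \<partial>std_normal \<partial>std_normal \<partial>gauss ?I)"
    by (rule split, rule measurable_compose[OF mG ind])
  also have "\<dots> = (\<integral>\<^sup>+X. \<integral>\<^sup>+x. \<integral>\<^sup>+y. indicator A (X(d := x, \<sigma> d := y)) \<partial>std_normal \<partial>std_normal \<partial>gauss ?I)"
  proof (rule nn_integral_cong)
    fix X assume X: "X \<in> space (gauss ?I)"
    have iff: "\<sigma> i = d \<longleftrightarrow> i = \<sigma> d" for i using inv by metis
    have g: "givens c s \<sigma> {d} (X(d := x, \<sigma> d := y)) = X(d := c * x + s * y, \<sigma> d := c * y - s * x)" for x y
      using d inv by (auto simp: givens_def fun_eq_iff iff)
    have m: "(\<lambda>(x, y). indicator A (X(d := x, \<sigma> d := y)) :: ennreal) \<in> borel_measurable (borel \<Otimes>\<^sub>M borel)"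
    proof -
      have "(\<lambda>p. X(d := fst p, \<sigma> d := snd p)) \<in> std_normal \<Otimes>\<^sub>M std_normal \<rightarrow>\<^sub>M gauss I"
        using d X by (intro measurable_fun_upd[where J="insert d ?I"] measurable_fun_upd[where J="?I"]) auto
      then have "(\<lambda>p. indicator A (X(d := fst p, \<sigma> d := snd p)) :: ennreal)
          \<in> borel_measurable (std_normal \<Otimes>\<^sub>M std_normal)"
        by (rule measurable_compose[OF _ ind])
      then show ?thesis unfolding case_prod_beta'
        by (simp cong: measurable_cong_sets add: measurable_cong_sets[OF sets_pair_measure_cong[OF sets_std_normal sets_std_normal] refl])
    qed
    show "(\<integral>\<^sup>+x. \<integral>\<^sup>+y. indicator A (givens c s \<sigma> {d} (X(d := x, \<sigma> d := y))) \<partial>std_normal \<partial>std_normal) =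
      (\<integral>\<^sup>+x. \<integral>\<^sup>+y. indicator A (X(d := x, \<sigma> d := y)) \<partial>std_normal \<partial>std_normal)"
      unfolding g using std_normal_rotation[OF m cs] by simp
  qed
  also have "\<dots> = (\<integral>\<^sup>+X. indicator A X \<partial>gauss I)" by (rule split[OF ind, symmetric])
  also have "\<dots> = emeasure (gauss I) A" by simp
  finally show "emeasure (distr (gauss I) (gauss I) (givens c s \<sigma> {d})) A = emeasure (gauss I) A" .
qed simp

lemma distr_givens:
  assumes fin: "finite I" and cs: "c\<^sup>2 + s\<^sup>2 = 1" and inv: "\<And>i. \<sigma> (\<sigma> i) = i"
    and D: "D \<subseteq> I" "\<sigma> ` D \<subseteq> I" "\<sigma> ` D \<inter> D = {}"
  shows "distr (gauss I) (gauss I) (givens c s \<sigma> D) = gauss I"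
proof -
  have "finite D" using D(1) fin finite_subset by blast
  then show ?thesis using D
  proof (induction D)
    case empty
    have "givens c s \<sigma> {} = (\<lambda>X. X)" by (simp add: givens_def fun_eq_iff)
    then show ?case by (simp add: distr_id2)
  next
    case (insert d D)
    have comp: "givens c s \<sigma> (insert d D) = givens c s \<sigma> {d} \<circ> givens c s \<sigma> D"
    proof -
      have a: "\<sigma> d \<notin> D" "\<sigma> d \<noteq> d" "d \<notin> D" using insert by auto
      have b: "\<sigma> i \<notin> D" if "i \<in> D" for i using insert that by auto
      have i: "\<sigma> i = d \<longleftrightarrow> i = \<sigma> d" for i using inv by metis
      show ?thesis using a b unfolding fun_eq_iff comp_def givens_def
        by (auto simp: inv i)
    qed
    have m: "givens c s \<sigma> D \<in> gauss I \<rightarrow>\<^sub>M gauss I" "givens c s \<sigma> {d} \<in> gauss I \<rightarrow>\<^sub>M gauss I"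
      using insert inv by (auto intro!: givens_measurable)
    have "distr (gauss I) (gauss I) (givens c s \<sigma> (insert d D)) =
        distr (distr (gauss I) (gauss I) (givens c s \<sigma> D)) (gauss I) (givens c s \<sigma> {d})"
      unfolding comp using m by (simp add: distr_distr)
    also have "\<dots> = gauss I"
      using insert distr_givens_single[OF fin cs inv, of d] by auto
    finally show ?case .
  qed
qed

section \<open>Merging two coordinates\<close>

lemma iexp_mult: "iexp x * iexp y = iexp (x + y)"
  by (simp add: exp_add distrib_left)

lemma integrable_iexp:
  assumes "prob_space M" "g \<in> borel_measurable M"
  shows "integrable M (\<lambda>x. iexp (g x))"
proof -
  interpret prob_space M by fact
  have [measurable]: "g \<in> borel_measurable M" by fact
  show ?thesis by (rule integrable_const_bound[where B=1]) (auto intro!: AE_I2)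
qed

lemma integral_resample:
  fixes f :: "('i \<Rightarrow> real) \<Rightarrow> complex"
  assumes fin: "finite I" and int: "integrable (gauss I) f"
  shows "integral\<^sup>L (gauss I) f = (\<integral>Z. \<integral>X. f (resample J Z X) \<partial>gauss I \<partial>gauss I)"
    and "integrable (gauss I) (\<lambda>Z. \<integral>X. f (resample J Z X) \<partial>gauss I)"
proof -
  interpret G: prob_space "gauss I" by (rule prob_space_gauss)
  interpret GG: pair_sigma_finite "gauss I" "gauss I" ..
  have [measurable]: "f \<in> borel_measurable (gauss I)" using int by simp
  have i: "integrable (gauss I \<Otimes>\<^sub>M gauss I) (\<lambda>p. f ((\<lambda>(Z, X). resample J Z X) p))"
    using int distr_resample[OF fin, of J] by (intro integrable_distr[OF resample_measurable]) simp
  then have i': "integrable (gauss I \<Otimes>\<^sub>M gauss I) (\<lambda>(Z, X). f (resample J Z X))"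
    by (simp add: case_prod_beta')
  have "integral\<^sup>L (gauss I) f = integral\<^sup>L (distr (gauss I \<Otimes>\<^sub>M gauss I) (gauss I) (\<lambda>(Z, X). resample J Z X)) f"
    by (simp add: distr_resample[OF fin])
  also have "\<dots> = (\<integral>p. f ((\<lambda>(Z, X). resample J Z X) p) \<partial>(gauss I \<Otimes>\<^sub>M gauss I))"
    by (rule integral_distr[OF resample_measurable]) simp
  also have "\<dots> = (\<integral>Z. \<integral>X. f (resample J Z X) \<partial>gauss I \<partial>gauss I)"
    using GG.integral_fst[OF i'] by (simp add: case_prod_beta')
  finally show "integral\<^sup>L (gauss I) f = (\<integral>Z. \<integral>X. f (resample J Z X) \<partial>gauss I \<partial>gauss I)" .
  show "integrable (gauss I) (\<lambda>Z. \<integral>X. f (resample J Z X) \<partial>gauss I)"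
    by (rule GG.integrable_fst[OF i'])
qed

lemma integral_givens:
  fixes f :: "('i \<Rightarrow> real) \<Rightarrow> complex"
  assumes fin: "finite I" and cs: "c\<^sup>2 + s\<^sup>2 = 1" and inv: "\<And>i. \<sigma> (\<sigma> i) = i"
    and D: "D \<subseteq> I" "\<sigma> ` D \<subseteq> I" "\<sigma> ` D \<inter> D = {}"
    and f: "f \<in> borel_measurable (gauss I)"
  shows "(\<integral>X. f (givens c s \<sigma> D X) \<partial>gauss I) = integral\<^sup>L (gauss I) f"
  using integral_distr[OF givens_measurable[OF inv D(1,2)] f, of c s]
    distr_givens[OF fin cs inv D] by simp

lemma sum_givens_identity:
  fixes A :: "'l \<Rightarrow> 'l \<Rightarrow> real"
  assumes "\<And>i j. A i j = A j i"
  shows "(\<Sum>i\<in>L. \<Sum>j\<in>L. A i j * ((c * x i + s * y i) * (c' * x j + s' * y j))) =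
    c * c' * (\<Sum>i\<in>L. \<Sum>j\<in>L. A i j * (x i * x j)) + s * s' * (\<Sum>i\<in>L. \<Sum>j\<in>L. A i j * (y i * y j)) +
    (c * s' + s * c') * (\<Sum>i\<in>L. \<Sum>j\<in>L. A i j * (x i * y j))"
proof -
  have sw: "(\<Sum>i\<in>L. \<Sum>j\<in>L. A i j * (y i * x j)) = (\<Sum>i\<in>L. \<Sum>j\<in>L. A i j * (x i * y j))"
  proof -
    have "(\<Sum>i\<in>L. \<Sum>j\<in>L. A i j * (y i * x j)) = (\<Sum>j\<in>L. \<Sum>i\<in>L. A i j * (y i * x j))" by (rule sum.swap)
    then show ?thesis using assms by (simp add: mult.commute)
  qed
  have "(\<Sum>i\<in>L. \<Sum>j\<in>L. A i j * ((c * x i + s * y i) * (c' * x j + s' * y j))) =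
    (\<Sum>i\<in>L. \<Sum>j\<in>L. c * c' * (A i j * (x i * x j)) + s * s' * (A i j * (y i * y j)) +
      c * s' * (A i j * (x i * y j)) + s * c' * (A i j * (y i * x j)))"
    by (intro sum.cong refl) (simp add: algebra_simps)
  also have "\<dots> = c * c' * (\<Sum>i\<in>L. \<Sum>j\<in>L. A i j * (x i * x j)) + s * s' * (\<Sum>i\<in>L. \<Sum>j\<in>L. A i j * (y i * y j)) +
    c * s' * (\<Sum>i\<in>L. \<Sum>j\<in>L. A i j * (x i * y j)) + s * c' * (\<Sum>i\<in>L. \<Sum>j\<in>L. A i j * (y i * x j))"
    by (simp add: sum.distrib sum_distrib_left)
  finally show ?thesis unfolding sw by (simp add: algebra_simps)
qed

text \<open>Write \<open>u, v\<close> for columns \<open>a, b\<close> and \<open>A(u, v)\<close>, \<open>\<alpha>(u)\<close> for the forms. Rotating the pair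
  \<open>(u, v)\<close> by 45 degrees diagonalises \<open>A(u, v)\<close> into \<open>(A(v, v) - A(u, u))/2\<close>, so that
  \<open>M x y\<close> splits into \<open>cnj (F ((x - y)/\<surd>2)) * F ((x + y)/\<surd>2)\<close> with
  \<open>F \<beta> = E exp(i(A(u, u)/2 + \<beta> \<alpha>(u)))\<close>. In particular \<open>M s 0 = |F (s/\<surd>2)|\<^sup>2\<close> is real and
  nonnegative. Rotating two independent copies by another angle shows that \<open>F \<beta>\<^sub>1 * F \<beta>\<^sub>2\<close> depends only on
  \<open>\<beta>\<^sub>1\<^sup>2 + \<beta>\<^sub>2\<^sup>2\<close>, hence \<open>|M x y|\<close> only on \<open>x\<^sup>2 + y\<^sup>2\<close>.\<close>

lemma merge_two_columns:
  fixes A :: "nat \<Rightarrow> nat \<Rightarrow> real" and \<alpha> :: "nat \<Rightarrow> real" and I :: "(nat \<times> nat) set"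
  assumes fin: "finite I" and ab: "a \<noteq> b" and sub: "L \<times> {a, b} \<subseteq> I"
    and sym: "\<And>i j. A i j = A j i"
  defines "M \<equiv> \<lambda>x y. \<integral>X. iexp ((\<Sum>i\<in>L. \<Sum>j\<in>L. A i j * (X (i, a) * X (j, b))) +
      (\<Sum>i\<in>L. \<alpha> i * (x * X (i, b) + y * X (i, a)))) \<partial>gauss I"
  shows "norm (M x y) = Re (M (sqrt (x\<^sup>2 + y\<^sup>2)) 0)"
proof -
  interpret G: prob_space "gauss I" by (rule prob_space_gauss)
  define Q where "Q k X = (\<Sum>i\<in>L. \<Sum>j\<in>L. A i j * (X (i, k) * X (j, k))) / 2" for k and X :: "nat \<times> nat \<Rightarrow> real"
  define l where "l k X = (\<Sum>i\<in>L. \<alpha> i * X (i, k))" for k and X :: "nat \<times> nat \<Rightarrow> real"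
  define F where "F \<beta> = (\<integral>X. iexp (Q a X + \<beta> * l a X) \<partial>gauss I)" for \<beta>
  let ?\<sigma> = "\<lambda>(i, j). (i, Transposition.transpose a b j)" and ?D = "L \<times> {a}"
  have comp [measurable]: "(\<lambda>X. X (i, k)) \<in> borel_measurable (gauss I)" if "i \<in> L" "k \<in> {a, b}" for i k
    using that sub by (intro gauss_component) auto
  have mQ: "Q k \<in> borel_measurable (gauss I)" and ml: "l k \<in> borel_measurable (gauss I)" if "k \<in> {a, b}" for k
    unfolding Q_def l_def using that
    by (intro borel_measurable_sum borel_measurable_times borel_measurable_divide borel_measurable_const comp; simp)+
  note [measurable] = mQ[of a, simplified] mQ[of b, simplified] ml[of a, simplified] ml[of b, simplified]
  have giv: "(\<integral>X. f (givens c s ?\<sigma> ?D X) \<partial>gauss I) = integral\<^sup>L (gauss I) f"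
    if "c\<^sup>2 + s\<^sup>2 = 1" "f \<in> borel_measurable (gauss I)" for c s and f :: "_ \<Rightarrow> complex"
    using that sub ab by (intro integral_givens[OF fin]) (auto simp: image_iff)
  have ga: "givens c s ?\<sigma> ?D X (i, a) = c * X (i, a) + s * X (i, b)"
   and gb: "givens c s ?\<sigma> ?D X (i, b) = - s * X (i, a) + c * X (i, b)" if "i \<in> L" for c s X i
    using that ab by (auto simp: givens_def)
  have la: "l a (givens c s ?\<sigma> ?D X) = c * l a X + s * l b X"
   and lb: "l b (givens c s ?\<sigma> ?D X) = - s * l a X + c * l b X" for c s X
    unfolding l_def by (simp_all add: ga gb algebra_simps sum.distrib sum_distrib_left sum_subtractf sum_negf)
  define C where "C X = (\<Sum>i\<in>L. \<Sum>j\<in>L. A i j * (X (i, a) * X (j, b)))" for X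
  have mC [measurable]: "C \<in> borel_measurable (gauss I)"
    unfolding C_def by (intro borel_measurable_sum borel_measurable_times borel_measurable_const comp; simp)
  have Qa: "Q a (givens c s ?\<sigma> ?D X) = c\<^sup>2 * Q a X + s\<^sup>2 * Q b X + c * s * C X"
   and Qb: "Q b (givens c s ?\<sigma> ?D X) = s\<^sup>2 * Q a X + c\<^sup>2 * Q b X - c * s * C X"
   and Cg: "C (givens c s ?\<sigma> ?D X) = 2 * c * s * (Q b X - Q a X) + (c\<^sup>2 - s\<^sup>2) * C X" for c s X
  proof -
    define S where "S x y = (\<Sum>i\<in>L. \<Sum>j\<in>L. A i j * (x i * y j))" for x y
    let ?a = "\<lambda>i. X (i, a)" and ?b = "\<lambda>i. X (i, b)"
    have S: "S (\<lambda>i. u * ?a i + v * ?b i) (\<lambda>i. u' * ?a i + v' * ?b i) =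
        u * u' * S ?a ?a + v * v' * S ?b ?b + (u * v' + v * u') * S ?a ?b" for u v u' v'
      unfolding S_def by (rule sum_givens_identity[OF sym])
    have Scong: "S x y = S x' y'" if "\<And>i. i \<in> L \<Longrightarrow> x i = x' i" "\<And>i. i \<in> L \<Longrightarrow> y i = y' i" for x y x' y'
      unfolding S_def using that by (intro sum.cong refl) auto
    have Q: "Q k Y = S (\<lambda>i. Y (i, k)) (\<lambda>i. Y (i, k)) / 2" and C: "C Y = S (\<lambda>i. Y (i, a)) (\<lambda>i. Y (i, b))" for k Y
      by (simp_all add: Q_def C_def S_def)
    have "S (\<lambda>i. givens c s ?\<sigma> ?D X (i, a)) (\<lambda>i. givens c s ?\<sigma> ?D X (i, a)) =
        S (\<lambda>i. c * ?a i + s * ?b i) (\<lambda>i. c * ?a i + s * ?b i)" by (rule Scong; rule ga)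
    then show "Q a (givens c s ?\<sigma> ?D X) = c\<^sup>2 * Q a X + s\<^sup>2 * Q b X + c * s * C X"
      unfolding Q C S by (simp add: power2_eq_square field_simps)
    have "S (\<lambda>i. givens c s ?\<sigma> ?D X (i, b)) (\<lambda>i. givens c s ?\<sigma> ?D X (i, b)) =
        S (\<lambda>i. - s * ?a i + c * ?b i) (\<lambda>i. - s * ?a i + c * ?b i)" by (rule Scong; rule gb)
    then show "Q b (givens c s ?\<sigma> ?D X) = s\<^sup>2 * Q a X + c\<^sup>2 * Q b X - c * s * C X"
      unfolding Q C S by (simp add: power2_eq_square field_simps)
    have "S (\<lambda>i. givens c s ?\<sigma> ?D X (i, a)) (\<lambda>i. givens c s ?\<sigma> ?D X (i, b)) =
        S (\<lambda>i. c * ?a i + s * ?b i) (\<lambda>i. - s * ?a i + c * ?b i)" by (rule Scong; (rule ga | rule gb))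
    then show "C (givens c s ?\<sigma> ?D X) = 2 * c * s * (Q b X - Q a X) + (c\<^sup>2 - s\<^sup>2) * C X"
      unfolding Q C S by (simp add: power2_eq_square field_simps)
  qed
  \<comment> \<open>Rotation by a right angle exchanges the two columns, so both have the same \<open>F\<close>.\<close>
  have Fb: "(\<integral>X. iexp (Q b X + \<beta> * l b X) \<partial>gauss I) = F \<beta>" for \<beta>
    using giv[of 0 1 "\<lambda>X. iexp (Q a X + \<beta> * l a X)"] by (simp add: F_def la Qa)
  have Fcnj: "(\<integral>X. iexp (- Q a X - \<beta> * l a X) \<partial>gauss I) = cnj (F \<beta>)" for \<beta>
  proof -
    have "iexp (- Q a X - \<beta> * l a X) = cnj (iexp (Q a X + \<beta> * l a X))" for X
      by (simp add: exp_cnj algebra_simps)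
    then show ?thesis by (simp only: F_def Bochner_Integration.integral_cnj)
  qed
  have prod: "(\<integral>X. iexp (f (Q a X) (l a X)) * iexp (g (Q b X) (l b X)) \<partial>gauss I) =
      (\<integral>X. iexp (f (Q a X) (l a X)) \<partial>gauss I) * (\<integral>X. iexp (g (Q b X) (l b X)) \<partial>gauss I)"
    if m [measurable]: "(\<lambda>(q, x). f q x :: real) \<in> borel_measurable (borel \<Otimes>\<^sub>M borel)" "(\<lambda>(q, x). g q x :: real) \<in> borel_measurable (borel \<Otimes>\<^sub>M borel)" for f g
  proof -
    have [simp]: "Q a (resample ?D Z X) = Q a Z" "l a (resample ?D Z X) = l a Z"
        "Q b (resample ?D Z X) = Q b X" "l b (resample ?D Z X) = l b X" for Z X
      using ab unfolding Q_def l_def resample_def by (auto intro!: sum.cong)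
    have "integrable (gauss I) (\<lambda>X. iexp (f (Q a X) (l a X) + g (Q b X) (l b X)))"
      by (intro integrable_iexp prob_space_gauss) measurable
    then have "integrable (gauss I) (\<lambda>X. iexp (f (Q a X) (l a X)) * iexp (g (Q b X) (l b X)))"
      by (simp add: distrib_left exp_add)
    from integral_resample(1)[OF fin this, of ?D] show ?thesis by simp
  qed
  define r where "r = 1 / sqrt 2"
  have r: "r\<^sup>2 + r\<^sup>2 = 1" "r\<^sup>2 = 1 / 2" "r * r = 1 / 2" by (simp_all add: r_def power2_eq_square field_simps)
  have MF: "M x y = cnj (F (r * (x - y))) * F (r * (x + y))" for x y
  proof -
    have "M x y = (\<integral>X. iexp (C X + x * l b X + y * l a X) \<partial>gauss I)"
      unfolding M_def C_def l_def
      by (simp add: sum.distrib sum_distrib_left algebra_simps)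
    also have "\<dots> = (\<integral>X. iexp (C (givens r r ?\<sigma> ?D X) + x * l b (givens r r ?\<sigma> ?D X) + y * l a (givens r r ?\<sigma> ?D X)) \<partial>gauss I)"
      by (rule giv[OF r(1), symmetric]) measurable
    also have "\<dots> = (\<integral>X. iexp (- Q a X - (r * (x - y)) * l a X) * iexp (Q b X + (r * (x + y)) * l b X) \<partial>gauss I)"
    proof (intro Bochner_Integration.integral_cong refl)
      fix X
      have r1: "2 * r * r = 1" by (simp add: mult.assoc r(3))
      have "C (givens r r ?\<sigma> ?D X) + x * l b (givens r r ?\<sigma> ?D X) + y * l a (givens r r ?\<sigma> ?D X) =
          (- Q a X - (r * (x - y)) * l a X) + (Q b X + (r * (x + y)) * l b X)"
        unfolding la lb Cg r1 by (simp add: algebra_simps)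
      then show "iexp (C (givens r r ?\<sigma> ?D X) + x * l b (givens r r ?\<sigma> ?D X) + y * l a (givens r r ?\<sigma> ?D X)) =
          iexp (- Q a X - (r * (x - y)) * l a X) * iexp (Q b X + (r * (x + y)) * l b X)"
        by (simp only: iexp_mult)
    qed
    also have "\<dots> = (\<integral>X. iexp (- Q a X - (r * (x - y)) * l a X) \<partial>gauss I) * (\<integral>X. iexp (Q b X + (r * (x + y)) * l b X) \<partial>gauss I)"
      by (rule prod) measurable
    finally show ?thesis by (simp only: Fb Fcnj)
  qed
  have FF: "F \<beta>1 * F \<beta>2 = F \<beta> * F \<beta>" if eq: "\<beta>1\<^sup>2 + \<beta>2\<^sup>2 = 2 * \<beta>\<^sup>2" for \<beta>1 \<beta>2 \<beta>
  proof (cases "\<beta> = 0")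
    case True then show ?thesis using eq by (simp add: sum_power2_eq_zero_iff)
  next
    case False
    \<comment> \<open>The rotation that carries \<open>(\<beta>, \<beta>)\<close> to \<open>(\<beta>1, \<beta>2)\<close>.\<close>
    define c s where "c = (\<beta>1 + \<beta>2) / (2 * \<beta>)" and "s = (\<beta>2 - \<beta>1) / (2 * \<beta>)"
    have "c\<^sup>2 + s\<^sup>2 = (\<beta>1\<^sup>2 + \<beta>2\<^sup>2) / (2 * \<beta>\<^sup>2)"
      using False by (simp add: c_def s_def power2_eq_square field_simps)
    then have cs: "c\<^sup>2 + s\<^sup>2 = 1" using eq False by simp
    have b12: "\<beta> * c - \<beta> * s = \<beta>1" "\<beta> * s + \<beta> * c = \<beta>2"
      using False by (simp_all add: c_def s_def field_simps)
    have dbl: "F u * F v = (\<integral>X. iexp (Q a X + Q b X + u * l a X + v * l b X) \<partial>gauss I)" for u v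
    proof -
      have "F u * F v = (\<integral>X. iexp (Q a X + u * l a X) \<partial>gauss I) * (\<integral>X. iexp (Q b X + v * l b X) \<partial>gauss I)"
        by (simp only: Fb) (simp add: F_def)
      also have "\<dots> = (\<integral>X. iexp (Q a X + u * l a X) * iexp (Q b X + v * l b X) \<partial>gauss I)"
        by (rule prod[symmetric]) measurable
      also have "\<dots> = (\<integral>X. iexp (Q a X + Q b X + u * l a X + v * l b X) \<partial>gauss I)"
        unfolding iexp_mult by (simp only: add_ac)
      finally show ?thesis .
    qed
    have "F \<beta> * F \<beta> = (\<integral>X. iexp (Q a (givens c s ?\<sigma> ?D X) + Q b (givens c s ?\<sigma> ?D X) +
        \<beta> * l a (givens c s ?\<sigma> ?D X) + \<beta> * l b (givens c s ?\<sigma> ?D X)) \<partial>gauss I)"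
      unfolding dbl by (rule giv[OF cs, symmetric]) measurable
    also have "\<dots> = (\<integral>X. iexp (Q a X + Q b X + \<beta>1 * l a X + \<beta>2 * l b X) \<partial>gauss I)"
    proof (intro Bochner_Integration.integral_cong refl arg_cong[where f=iexp])
      fix X
      have "Q a (givens c s ?\<sigma> ?D X) + Q b (givens c s ?\<sigma> ?D X) = (c\<^sup>2 + s\<^sup>2) * (Q a X + Q b X)"
        by (simp add: Qa Qb algebra_simps)
      moreover have "\<beta> * l a (givens c s ?\<sigma> ?D X) + \<beta> * l b (givens c s ?\<sigma> ?D X) = \<beta>1 * l a X + \<beta>2 * l b X"
        unfolding b12[symmetric] by (simp add: la lb algebra_simps)
      ultimately show "Q a (givens c s ?\<sigma> ?D X) + Q b (givens c s ?\<sigma> ?D X) +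
        \<beta> * l a (givens c s ?\<sigma> ?D X) + \<beta> * l b (givens c s ?\<sigma> ?D X) = Q a X + Q b X + \<beta>1 * l a X + \<beta>2 * l b X"
        using cs by simp
    qed
    finally show ?thesis by (simp add: dbl)
  qed
  let ?s = "sqrt (x\<^sup>2 + y\<^sup>2)"
  have "(r * (x - y))\<^sup>2 + (r * (x + y))\<^sup>2 = 2 * (r * ?s)\<^sup>2"
    by (simp add: power_mult_distrib power2_eq_square[of "x - y"] power2_eq_square[of "x + y"])
      (simp add: algebra_simps power2_eq_square)
  from FF[OF this] have "norm (M x y) = norm (F (r * ?s)) * norm (F (r * ?s))"
    unfolding MF by (metis complex_mod_cnj norm_mult)
  also have "\<dots> = Re (M ?s 0)"
    by (simp add: MF cmod_power2 flip: power2_eq_square)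
  finally show ?thesis .
qed

section \<open>Comparison of characteristic functions\<close>

definition cf :: "(nat \<times> nat) set \<Rightarrow> nat set \<Rightarrow> nat set \<Rightarrow> real \<Rightarrow> complex" where
  "cf I R V t = (\<integral>X. iexp (t * gram_haf R V X) \<partial>gauss I)"

lemma gram_haf_measurable:
  assumes "\<And>i j. i \<in> R \<Longrightarrow> j \<in> V \<Longrightarrow> (\<lambda>x. Y x (i, j)) \<in> borel_measurable M"
  shows "(\<lambda>x. gram_haf R V (Y x)) \<in> borel_measurable M"
  unfolding gram_haf_def hafs_def
proof (intro borel_measurable_sum borel_measurable_prod)
  fix m e assume m: "m \<in> perfect_matchings V" "e \<in> m"
  have "finite e" "e \<noteq> {}" using perfect_matchings_edge(2)[OF m] card_gt_0_iff[of e] by auto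
  then have "Min e \<in> e" "Max e \<in> e" by auto
  then have "Min e \<in> V" "Max e \<in> V" using perfect_matchings_edge(1)[OF m] by auto
  then show "(\<lambda>x. gram R (Y x) (Min e) (Max e)) \<in> borel_measurable M"
    unfolding gram_def by (intro borel_measurable_sum borel_measurable_times assms)
qed

definition with_col :: "nat \<Rightarrow> (nat \<Rightarrow> real) \<Rightarrow> (nat \<times> nat \<Rightarrow> real) \<Rightarrow> nat \<times> nat \<Rightarrow> real" where
  "with_col p v X = (\<lambda>(i, j). if j = p then v i else X (i, j))"

definition with_row :: "nat \<Rightarrow> (nat \<Rightarrow> real) \<Rightarrow> (nat \<times> nat \<Rightarrow> real) \<Rightarrow> nat \<times> nat \<Rightarrow> real" where
  "with_row e g X = (\<lambda>(i, j). if i = e then g j else X (i, j))"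

text \<open>Repeated merging of two coordinates collects the Euclidean length of \<open>g\<close> in the coordinate \<open>q\<close>.
  At least two coordinates are required: with \<open>V = {q}\<close> no step applies, and \<open>g q\<close> could not be
  replaced by \<open>\<bar>g q\<bar>\<close>.\<close>

lemma merge_all:
  fixes \<Phi> :: "('l \<Rightarrow> real) \<Rightarrow> real"
  assumes fin: "finite V" and q: "q \<in> V" "V \<noteq> {q}"
    and step: "\<And>g a b. a \<in> V \<Longrightarrow> b \<in> V \<Longrightarrow> a \<noteq> b \<Longrightarrow> \<Phi> g \<le> \<Phi> (g(a := sqrt ((g a)\<^sup>2 + (g b)\<^sup>2), b := 0))"
  shows "\<Phi> g \<le> \<Phi> (\<lambda>j. if j \<in> V then if j = q then sqrt (\<Sum>i\<in>V. (g i)\<^sup>2) else 0 else g j)"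
proof -
  have "\<Phi> g \<le> \<Phi> (\<lambda>j. if j \<in> W then 0 else if j = q then sqrt ((g q)\<^sup>2 + (\<Sum>i\<in>W. (g i)\<^sup>2)) else g j)"
    if "finite W" "W \<noteq> {}" "W \<subseteq> V - {q}" for W
    using that
  proof (induction W rule: finite_ne_induct)
    case (singleton b)
    have "(g(q := sqrt ((g q)\<^sup>2 + (g b)\<^sup>2), b := 0)) =
        (\<lambda>j. if j \<in> {b} then 0 else if j = q then sqrt ((g q)\<^sup>2 + (\<Sum>i\<in>{b}. (g i)\<^sup>2)) else g j)"
      by (auto simp: fun_eq_iff)
    then show ?case using step[of q b g] singleton q by auto
  next
    case (insert b W)
    define h where "h = (\<lambda>j. if j \<in> W then 0 else if j = q then sqrt ((g q)\<^sup>2 + (\<Sum>i\<in>W. (g i)\<^sup>2)) else g j)"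
    have n: "0 \<le> (g q)\<^sup>2 + (\<Sum>i\<in>W. (g i)\<^sup>2)" by (intro add_nonneg_nonneg sum_nonneg) auto
    have "\<Phi> g \<le> \<Phi> h" using insert by (simp add: h_def)
    also have "\<Phi> h \<le> \<Phi> (h(q := sqrt ((h q)\<^sup>2 + (h b)\<^sup>2), b := 0))"
      using insert q by (intro step) auto
    also have "h(q := sqrt ((h q)\<^sup>2 + (h b)\<^sup>2), b := 0) =
      (\<lambda>j. if j \<in> insert b W then 0 else if j = q then sqrt ((g q)\<^sup>2 + (\<Sum>i\<in>insert b W. (g i)\<^sup>2)) else g j)"
      using insert n by (auto simp: fun_eq_iff h_def add_ac)
    finally show ?case .
  qed
  from this[of "V - {q}"] have "\<Phi> g \<le> \<Phi> (\<lambda>j. if j \<in> V - {q} then 0 else if j = q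
      then sqrt ((g q)\<^sup>2 + (\<Sum>i\<in>V - {q}. (g i)\<^sup>2)) else g j)" using fin q by auto
  also have "(\<lambda>j. if j \<in> V - {q} then 0 else if j = q then sqrt ((g q)\<^sup>2 + (\<Sum>i\<in>V - {q}. (g i)\<^sup>2)) else g j) =
     (\<lambda>j. if j \<in> V then if j = q then sqrt (\<Sum>i\<in>V. (g i)\<^sup>2) else 0 else g j)"
    using q fin by (auto simp: fun_eq_iff sum.remove[of V q])
  finally show ?thesis .
qed

lemma gram_haf_givens_rows:
  assumes "finite R" "i \<in> R" "i' \<in> R" "i \<noteq> i'" and cs: "c\<^sup>2 + s\<^sup>2 = 1"
  shows "gram_haf R V (givens c s (\<lambda>(r, j). (Transposition.transpose i i' r, j)) ({i} \<times> V) X) = gram_haf R V X"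
  unfolding gram_haf_def
proof (rule hafs_cong)
  fix a b assume ab: "a \<in> V" "b \<in> V"
  let ?G = "givens c s (\<lambda>(r, j). (Transposition.transpose i i' r, j)) ({i} \<times> V) X"
  have G: "?G (i, j) = c * X (i, j) + s * X (i', j)" "?G (i', j) = c * X (i', j) - s * X (i, j)" if "j \<in> V" for j
    using that assms(4) by (auto simp: givens_def)
  have G': "?G (r, j) = X (r, j)" if "r \<in> R - {i} - {i'}" for r j
    using that assms(4) by (auto simp: givens_def Transposition.transpose_def)
  have sp: "(\<Sum>r\<in>R. f r) = f i + (f i' + (\<Sum>r\<in>R - {i} - {i'}. f r))" for f :: "nat \<Rightarrow> real"
    using assms by (simp add: sum.remove[of R i] sum.remove[of "R - {i}" i'])
  have "?G (i, a) * ?G (i, b) + ?G (i', a) * ?G (i', b) = (c\<^sup>2 + s\<^sup>2) * (X (i, a) * X (i, b) + X (i', a) * X (i', b))"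
    using ab by (simp add: G power2_eq_square algebra_simps)
  then show "gram R ?G a b = gram R X a b"
    unfolding gram_def sp using cs G' by simp
qed

text \<open>The rotation of rows \<open>i, i'\<close> that turns \<open>(v i, v i')\<close> into \<open>(\<rho>, 0)\<close> fixes all inner products
  of columns and preserves the law of the remaining columns.\<close>

lemma col_merge:
  assumes fin: "finite I" "finite R" and sub: "R \<times> V \<subseteq> I" and p: "p \<in> V"
    and ii: "i \<in> R" "i' \<in> R" "i \<noteq> i'"
  shows "(\<integral>X. iexp (t * gram_haf R V (with_col p v X)) \<partial>gauss I) =
    (\<integral>X. iexp (t * gram_haf R V (with_col p (v(i := sqrt ((v i)\<^sup>2 + (v i')\<^sup>2), i' := 0)) X)) \<partial>gauss I)"
proof (cases "v i = 0 \<and> v i' = 0")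
  case True
  then have "v(i := sqrt ((v i)\<^sup>2 + (v i')\<^sup>2), i' := 0) = v" by (auto simp: fun_eq_iff)
  then show ?thesis by simp
next
  case False
  define \<rho> where "\<rho> = sqrt ((v i)\<^sup>2 + (v i')\<^sup>2)"
  have rpos: "\<rho> \<noteq> 0" using False by (simp add: \<rho>_def sum_power2_eq_zero_iff)
  have r2: "\<rho>\<^sup>2 = (v i)\<^sup>2 + (v i')\<^sup>2" by (simp add: \<rho>_def)
  define c s where "c = v i / \<rho>" and "s = v i' / \<rho>"
  have cs: "c\<^sup>2 + s\<^sup>2 = 1" 
  proof -
    have "c\<^sup>2 + s\<^sup>2 = ((v i)\<^sup>2 + (v i')\<^sup>2) / \<rho>\<^sup>2"
      by (simp add: c_def s_def power_divide add_divide_distrib)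
    then show ?thesis unfolding r2[symmetric] using rpos by simp
  qed
  let ?\<sigma> = "\<lambda>(r, j). (Transposition.transpose i i' r, j)" and ?D = "{i} \<times> V"
  let ?G = "givens c s ?\<sigma> ?D" and ?v = "v(i := \<rho>, i' := 0)"
  have col: "c * v i + s * v i' = \<rho>" "c * v i' - s * v i = 0"
  proof -
    have "c * v i + s * v i' = ((v i)\<^sup>2 + (v i')\<^sup>2) / \<rho>"
      by (simp add: c_def s_def power2_eq_square add_divide_distrib)
    then show "c * v i + s * v i' = \<rho>" unfolding r2[symmetric] using rpos by (simp add: power2_eq_square)
    show "c * v i' - s * v i = 0" by (simp add: c_def s_def)
  qed
  have m: "(\<lambda>X. iexp (t * gram_haf R V (with_col p w X))) \<in> borel_measurable (gauss I)" for w
  proof -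
    have "(\<lambda>X. gram_haf R V (with_col p w X)) \<in> borel_measurable (gauss I)"
      using sub by (intro gram_haf_measurable) (auto simp: with_col_def intro!: gauss_component)
    then show ?thesis by simp
  qed
  have "gram_haf R V (with_col p ?v (?G X)) = gram_haf R V (with_col p v X)" for X
  proof -
    have "gram_haf R V (with_col p ?v (?G X)) = gram_haf R V (?G (with_col p v X))"
    proof (rule gram_haf_cong)
      fix r j assume "r \<in> R" "j \<in> V"
      then show "with_col p ?v (?G X) (r, j) = ?G (with_col p v X) (r, j)"
        using ii p col by (auto simp: with_col_def givens_def Transposition.transpose_def)
    qed
    also have "\<dots> = gram_haf R V (with_col p v X)"
      by (rule gram_haf_givens_rows[OF fin(2) ii cs])
    finally show ?thesis .
  qed
  then have "(\<integral>X. iexp (t * gram_haf R V (with_col p v X)) \<partial>gauss I) =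
    (\<integral>X. iexp (t * gram_haf R V (with_col p ?v (?G X))) \<partial>gauss I)" by simp
  also have "\<dots> = (\<integral>X. iexp (t * gram_haf R V (with_col p ?v X)) \<partial>gauss I)"
    using sub ii by (intro integral_givens[OF fin(1) cs _ _ _ _ m]) auto
  finally show ?thesis by (simp add: \<rho>_def)
qed

text \<open>Condition on all columns except \<open>a\<close> and \<open>b\<close>. The hafnian is then a symmetric bilinear form in these two
  columns; separating row \<open>e\<close> leaves a deterministic phase \<open>A\<^bsub>ee\<^esub> g\<^sub>a g\<^sub>b\<close> and an expression to
  which \<open>merge_two_columns\<close> applies. After merging, the phase vanishes and the conditional expectation is
  real and nonnegative for every value of the other columns, so taking norms inside the outer
  integral loses nothing.\<close>

lemma row_merge:
  fixes v :: "nat \<Rightarrow> real" and t :: real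
  assumes fin: "finite I" "finite R" "finite V" and sub: "R \<times> V \<subseteq> I" and e: "e \<in> R"
    and p: "p \<in> V" and ab: "a \<in> V - {p}" "b \<in> V - {p}" "a \<noteq> b"
  defines "\<Psi> \<equiv> \<lambda>g. \<integral>X. iexp (t * gram_haf R V (with_col p v (with_row e g X))) \<partial>gauss I"
  shows "norm (\<Psi> g) \<le> norm (\<Psi> (g(a := sqrt ((g a)\<^sup>2 + (g b)\<^sup>2), b := 0)))"
proof -
  interpret G: prob_space "gauss I" by (rule prob_space_gauss)
  let ?g = "g(a := sqrt ((g a)\<^sup>2 + (g b)\<^sup>2), b := 0)"
  \<comment> \<open>Resampling the complement of the free entries puts their integral innermost.\<close>
  let ?L = "R - {e}" and ?J = "I - (R - {e}) \<times> {a, b}"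
  define H where "H g X = t * gram_haf R V (with_col p v (with_row e g X))" for g X
  have mH: "H g \<in> borel_measurable (gauss I)" for g
  proof -
    have "(\<lambda>X. gram_haf R V (with_col p v (with_row e g X))) \<in> borel_measurable (gauss I)"
      using sub by (intro gram_haf_measurable) (auto simp: with_col_def with_row_def intro!: gauss_component)
    then show ?thesis unfolding H_def by simp
  qed
  define K where "K g Z = (\<integral>X. iexp (H g (resample ?J Z X)) \<partial>gauss I)" for g Z
  have int: "integrable (gauss I) (\<lambda>X. iexp (H g X))" for g
    by (rule integrable_iexp[OF prob_space_gauss mH])
  have \<Psi>: "\<Psi> g = (\<integral>Z. K g Z \<partial>gauss I)" and intK: "integrable (gauss I) (K g)" for g
    using integral_resample[OF fin(1) int, of g ?J] unfolding \<Psi>_def K_def H_def by auto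
  have main: "norm (K g Z) = Re (K ?g Z)" for Z
  proof -
    obtain A where sym: "\<And>i j. A i j = A j i" and A: "\<And>X. (\<And>i j. i \<in> R \<Longrightarrow> j \<in> V - {a, b} \<Longrightarrow>
        X (i, j) = with_col p v (with_row e g Z) (i, j)) \<Longrightarrow>
      gram_haf R V X = (\<Sum>i\<in>R. \<Sum>j\<in>R. A i j * (X (i, a) * X (j, b)))"
      using gram_haf_bilinear[OF fin(3,2) _ _ ab(3), where W="with_col p v (with_row e g Z)"] ab by blast
    define B where "B i j = t * A i j" for i j
    have Bsym: "B i j = B j i" for i j by (simp add: B_def sym)
    define Mm where "Mm x y = (\<integral>X. iexp ((\<Sum>i\<in>?L. \<Sum>j\<in>?L. B i j * (X (i, a) * X (j, b))) +
      (\<Sum>i\<in>?L. B e i * (x * X (i, b) + y * X (i, a)))) \<partial>gauss I)" for x y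
    have K: "K h Z = iexp (B e e * (h a * h b)) * Mm (h a) (h b)"
      if h: "\<And>j. j \<in> V - {a, b} \<Longrightarrow> h j = g j" for h
    proof -
      have "H h (resample ?J Z X) = B e e * (h a * h b) + ((\<Sum>i\<in>?L. \<Sum>j\<in>?L. B i j * (X (i, a) * X (j, b))) +
        (\<Sum>i\<in>?L. B e i * (h a * X (i, b) + h b * X (i, a))))" for X
      proof -
        let ?Y = "with_col p v (with_row e h (resample ?J Z X))"
        have Y: "?Y (e, a) = h a" "?Y (e, b) = h b" "i \<in> ?L \<Longrightarrow> ?Y (i, a) = X (i, a)" "i \<in> ?L \<Longrightarrow> ?Y (i, b) = X (i, b)" for i
          using ab by (auto simp: with_col_def with_row_def resample_def)
        have "gram_haf R V ?Y = (\<Sum>i\<in>R. \<Sum>j\<in>R. A i j * (?Y (i, a) * ?Y (j, b)))"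
          using h sub by (intro A) (auto simp: with_col_def with_row_def resample_def)
        then have "H h (resample ?J Z X) = (\<Sum>i\<in>R. \<Sum>j\<in>R. B i j * (?Y (i, a) * ?Y (j, b)))"
          unfolding H_def B_def by (simp add: sum_distrib_left mult.assoc)
        also have "\<dots> = B e e * (h a * h b) + (\<Sum>j\<in>?L. B e j * (h a * X (j, b))) +
            ((\<Sum>i\<in>?L. B i e * (X (i, a) * h b)) + (\<Sum>i\<in>?L. \<Sum>j\<in>?L. B i j * (X (i, a) * X (j, b))))"
          using fin e by (simp add: sum.remove[of R e] Y sum.distrib)
        also have "(\<Sum>i\<in>?L. B i e * (X (i, a) * h b)) = (\<Sum>i\<in>?L. B e i * (X (i, a) * h b))"
          by (intro sum.cong refl arg_cong2[where f="(*)"] Bsym)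
        finally show ?thesis
          by (simp add: sum.distrib algebra_simps)
      qed
      then show ?thesis unfolding K_def Mm_def by (simp add: distrib_left exp_add)
    qed
    have sub': "?L \<times> {a, b} \<subseteq> I" using sub ab by auto
    have "norm (K g Z) = norm (Mm (g a) (g b))" by (subst K) (auto simp: norm_mult)
    also have "\<dots> = Re (Mm (sqrt ((g a)\<^sup>2 + (g b)\<^sup>2)) 0)"
      unfolding Mm_def by (rule merge_two_columns[OF fin(1) ab(3) sub' Bsym])
    also have "\<dots> = Re (K ?g Z)" using ab(3) by (subst K) auto
    finally show ?thesis .
  qed
  have "norm (\<Psi> g) \<le> (\<integral>Z. norm (K g Z) \<partial>gauss I)" unfolding \<Psi> by (rule integral_norm_bound)
  also have "\<dots> = Re (\<Psi> ?g)" unfolding main \<Psi> using intK by (rule Bochner_Integration.integral_Re)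
  also have "\<dots> \<le> norm (\<Psi> ?g)" by (rule complex_Re_le_cmod)
  finally show ?thesis .
qed

lemma norm_integral_resample_le:
  fixes f :: "('i \<Rightarrow> real) \<Rightarrow> complex"
  assumes fin: "finite I" and int: "integrable (gauss I) f"
  shows "ennreal (norm (integral\<^sup>L (gauss I) f)) \<le>
    (\<integral>\<^sup>+Z. ennreal (norm (\<integral>X. f (resample J Z X) \<partial>gauss I)) \<partial>gauss I)"
  unfolding integral_resample(1)[OF assms, of J]
  by (rule integral_norm_bound_ennreal[OF integral_resample(2)[OF assms]])

lemma integrable_gram_haf:
  assumes "\<And>i j. i \<in> R \<Longrightarrow> j \<in> V \<Longrightarrow> (\<lambda>x. Y x (i, j)) \<in> borel_measurable (gauss I)"
  shows "integrable (gauss I) (\<lambda>X. iexp (t * gram_haf R V (Y X)))"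
  using gram_haf_measurable[of R V Y "gauss I"] assms
  by (intro integrable_iexp prob_space_gauss) auto

definition axis_vec :: "nat \<Rightarrow> real \<Rightarrow> nat \<Rightarrow> real" where
  "axis_vec e \<rho> = (\<lambda>i. if i = e then \<rho> else 0)"

lemma cf_le_col:
  assumes fin: "finite I" "finite R" and sub: "R \<times> V \<subseteq> I" and p: "p \<in> V"
    and e: "e \<in> R" "R \<noteq> {e}"
  shows "ennreal (norm (cf I R V t)) \<le> (\<integral>\<^sup>+Z. ennreal (norm
    (\<integral>X. iexp (t * gram_haf R V (with_col p (axis_vec e (sqrt (\<Sum>i\<in>R. (Z (i, p))\<^sup>2))) X)) \<partial>gauss I)) \<partial>gauss I)"
proof -
  let ?J = "R \<times> {p}"
  have int: "integrable (gauss I) (\<lambda>X. iexp (t * gram_haf R V X))"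
    using sub by (intro integrable_gram_haf gauss_component) auto
  have "ennreal (norm (cf I R V t)) \<le>
      (\<integral>\<^sup>+Z. ennreal (norm (\<integral>X. iexp (t * gram_haf R V (resample ?J Z X)) \<partial>gauss I)) \<partial>gauss I)"
    unfolding cf_def by (rule norm_integral_resample_le[OF fin(1) int])
  also have "\<dots> \<le> (\<integral>\<^sup>+Z. ennreal (norm
    (\<integral>X. iexp (t * gram_haf R V (with_col p (axis_vec e (sqrt (\<Sum>i\<in>R. (Z (i, p))\<^sup>2))) X)) \<partial>gauss I)) \<partial>gauss I)"
  proof (intro nn_integral_mono ennreal_leI)
    fix Z :: "nat \<times> nat \<Rightarrow> real"
    let ?\<Phi> = "\<lambda>v. norm (\<integral>X. iexp (t * gram_haf R V (with_col p v X)) \<partial>gauss I)"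
    have "gram_haf R V (resample ?J Z X) = gram_haf R V (with_col p (\<lambda>i. Z (i, p)) X)" for X
      by (rule gram_haf_cong) (auto simp: resample_def with_col_def)
    then have "norm (\<integral>X. iexp (t * gram_haf R V (resample ?J Z X)) \<partial>gauss I) = ?\<Phi> (\<lambda>i. Z (i, p))" by simp
    also have "\<dots> \<le> ?\<Phi> (\<lambda>j. if j \<in> R then if j = e then sqrt (\<Sum>i\<in>R. (Z (i, p))\<^sup>2) else 0 else Z (j, p))"
      by (rule merge_all[OF fin(2) e, of ?\<Phi>], rule eq_refl, rule arg_cong[where f=norm])
        (rule col_merge[OF fin sub p])
    also have "\<dots> = ?\<Phi> (axis_vec e (sqrt (\<Sum>i\<in>R. (Z (i, p))\<^sup>2)))"
    proof -
      have "gram_haf R V (with_col p (\<lambda>j. if j \<in> R then if j = e then sqrt (\<Sum>i\<in>R. (Z (i, p))\<^sup>2) else 0 else Z (j, p)) X) =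
        gram_haf R V (with_col p (axis_vec e (sqrt (\<Sum>i\<in>R. (Z (i, p))\<^sup>2))) X)" for X
        using e by (intro gram_haf_cong) (auto simp: with_col_def axis_vec_def)
      then show ?thesis by simp
    qed
    finally show "norm (\<integral>X. iexp (t * gram_haf R V (resample ?J Z X)) \<partial>gauss I) \<le>
      ?\<Phi> (axis_vec e (sqrt (\<Sum>i\<in>R. (Z (i, p))\<^sup>2)))" .
  qed
  finally show ?thesis .
qed

lemma cf_axis_le_row:
  assumes fin: "finite I" "finite R" "finite V" and sub: "R \<times> V \<subseteq> I" and p: "p \<in> V"
    and e: "e \<in> R" and q: "q \<in> V - {p}" "V \<noteq> {p, q}"
  shows "ennreal (norm (\<integral>X. iexp (t * gram_haf R V (with_col p (axis_vec e \<rho>) X)) \<partial>gauss I)) \<le>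
    (\<integral>\<^sup>+Z. ennreal (norm (cf I (R - {e}) (V - {p, q}) (t * \<rho> * sqrt (\<Sum>j\<in>V - {p}. (Z (e, j))\<^sup>2)))) \<partial>gauss I)"
proof -
  let ?J = "{e} \<times> (V - {p})"
  have int: "integrable (gauss I) (\<lambda>X. iexp (t * gram_haf R V (with_col p (axis_vec e \<rho>) X)))"
    using sub by (intro integrable_gram_haf) (auto simp: with_col_def intro!: gauss_component)
  have "ennreal (norm (\<integral>X. iexp (t * gram_haf R V (with_col p (axis_vec e \<rho>) X)) \<partial>gauss I)) \<le>
      (\<integral>\<^sup>+Z. ennreal (norm (\<integral>X. iexp (t * gram_haf R V (with_col p (axis_vec e \<rho>) (resample ?J Z X))) \<partial>gauss I)) \<partial>gauss I)"
    by (rule norm_integral_resample_le[OF fin(1) int])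
  also have "\<dots> \<le> (\<integral>\<^sup>+Z. ennreal (norm (cf I (R - {e}) (V - {p, q}) (t * \<rho> * sqrt (\<Sum>j\<in>V - {p}. (Z (e, j))\<^sup>2)))) \<partial>gauss I)"
  proof (intro nn_integral_mono ennreal_leI)
    fix Z :: "nat \<times> nat \<Rightarrow> real"
    let ?s = "sqrt (\<Sum>j\<in>V - {p}. (Z (e, j))\<^sup>2)"
    let ?g = "\<lambda>j. if j \<in> V - {p} then if j = q then ?s else 0 else Z (e, j)"
    let ?\<Psi> = "\<lambda>g. norm (\<integral>X. iexp (t * gram_haf R V (with_col p (axis_vec e \<rho>) (with_row e g X))) \<partial>gauss I)"
    have "gram_haf R V (with_col p (axis_vec e \<rho>) (resample ?J Z X)) =
        gram_haf R V (with_col p (axis_vec e \<rho>) (with_row e (\<lambda>j. Z (e, j)) X))" for X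
      by (rule gram_haf_cong) (auto simp: resample_def with_col_def with_row_def)
    then have "norm (\<integral>X. iexp (t * gram_haf R V (with_col p (axis_vec e \<rho>) (resample ?J Z X))) \<partial>gauss I) =
        ?\<Psi> (\<lambda>j. Z (e, j))" by simp
    also have "\<dots> \<le> ?\<Psi> ?g"
      using q p fin by (intro merge_all[of "V - {p}" q ?\<Psi>] row_merge[OF fin sub e p]) auto
    also have "\<dots> = norm (cf I (R - {e}) (V - {p, q}) (t * \<rho> * ?s))"
    proof -
      have "gram_haf R V (with_col p (axis_vec e \<rho>) (with_row e ?g X)) =
          \<rho> * ?s * gram_haf (R - {e}) (V - {p, q}) X" for X
      proof -
        let ?Y = "with_col p (axis_vec e \<rho>) (with_row e ?g X)"
        have "gram_haf R V ?Y = ?Y (e, p) * ?Y (e, q) * gram_haf (R - {e}) (V - {p, q}) ?Y"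
          using q p e by (intro gram_haf_pivot fin) (auto simp: with_col_def with_row_def axis_vec_def)
        also have "gram_haf (R - {e}) (V - {p, q}) ?Y = gram_haf (R - {e}) (V - {p, q}) X"
          by (rule gram_haf_cong) (auto simp: with_col_def with_row_def)
        finally show ?thesis using q by (simp add: with_col_def with_row_def axis_vec_def)
      qed
      then show ?thesis by (simp add: cf_def mult.assoc)
    qed
    finally show "norm (\<integral>X. iexp (t * gram_haf R V (with_col p (axis_vec e \<rho>) (resample ?J Z X))) \<partial>gauss I) \<le>
      norm (cf I (R - {e}) (V - {p, q}) (t * \<rho> * ?s))" .
  qed
  finally show ?thesis .
qed

section \<open>Integrals of the characteristic function\<close>

lemma cf_measurable:
  assumes "R \<times> V \<subseteq> I"
  shows "cf I R V \<in> borel_measurable borel"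
proof -
  interpret G: prob_space "gauss I" by (rule prob_space_gauss)
  have [measurable]: "(\<lambda>X. gram_haf R V X) \<in> borel_measurable (gauss I)"
    using assms by (intro gram_haf_measurable gauss_component) auto
  have "(\<lambda>(t, X). iexp (t * gram_haf R V X)) \<in> borel_measurable (borel \<Otimes>\<^sub>M gauss I)"
    by measurable
  then show ?thesis
    unfolding cf_def[abs_def] by (rule G.borel_measurable_lebesgue_integral)
qed

lemma sets_chi_square [simp, measurable_cong]: "sets (chi_square d) = sets borel"
  by (simp add: chi_square_def)

lemma space_chi_square [simp]: "space (chi_square d) = UNIV"
  by (simp add: chi_square_def)

lemma sum_squares_measurable:
  assumes "h ` K \<subseteq> I"
  shows "(\<lambda>X. \<Sum>i\<in>K. (X (h i))\<^sup>2) \<in> borel_measurable (gauss I)"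
  using assms by (intro borel_measurable_sum borel_measurable_power gauss_component) auto

lemma prob_space_chi_square: "prob_space (chi_square d)"
  unfolding chi_square_def using sum_squares_measurable[of "\<lambda>i. i" "{..<d}" "{..<d}"]
  by (intro prob_space.prob_space_distr prob_space_gauss) auto

lemma nn_integral_chi_square:
  assumes K: "finite K" "inj_on h K" "h ` K \<subseteq> I"
    and f: "f \<in> borel_measurable borel"
  shows "(\<integral>\<^sup>+X. f (\<Sum>i\<in>K. (X (h i))\<^sup>2) \<partial>gauss I) = (\<integral>\<^sup>+y. f y \<partial>chi_square (card K))"
proof -
  let ?d = "{..<card K}"
  obtain b where b: "bij_betw b ?d K"
    using ex_bij_betw_nat_finite[OF K(1)] by (auto simp: atLeast0LessThan)
  then have bK: "b n \<in> K" if "n < card K" for n using that by (auto simp: bij_betw_def)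
  have inj: "inj_on (h \<circ> b) ?d" using b K(2) by (auto simp: bij_betw_def intro: comp_inj_on)
  have im: "h \<circ> b \<in> ?d \<rightarrow> I" using bK K(3) by auto
  let ?r = "\<lambda>X. \<lambda>n\<in>?d. X ((h \<circ> b) n)"
  have re: "distr (gauss I) (gauss ?d) ?r = gauss ?d"
    using distr_PiM_reindex[of I "\<lambda>_. std_normal" "h \<circ> b" ?d] inj im prob_space_std_normal by simp
  have mr: "?r \<in> gauss I \<rightarrow>\<^sub>M gauss ?d"
    using im by (intro measurable_restrict measurable_component_singleton) auto
  have ms: "(\<lambda>x. \<Sum>i<card K. (x i)\<^sup>2) \<in> borel_measurable (gauss ?d)"
    using sum_squares_measurable[of "\<lambda>i. i" ?d ?d] by simp
  have "(\<integral>\<^sup>+y. f y \<partial>chi_square (card K)) = (\<integral>\<^sup>+x. f (\<Sum>i<card K. (x i)\<^sup>2) \<partial>gauss ?d)"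
    unfolding chi_square_def using ms f by (intro nn_integral_distr) auto
  also have "\<dots> = (\<integral>\<^sup>+x. f (\<Sum>i<card K. (x i)\<^sup>2) \<partial>distr (gauss I) (gauss ?d) ?r)" by (simp only: re)
  also have "\<dots> = (\<integral>\<^sup>+X. f (\<Sum>i<card K. (?r X i)\<^sup>2) \<partial>gauss I)"
    using nn_integral_distr[OF mr, of "\<lambda>x. f (\<Sum>i<card K. (x i)\<^sup>2)"] measurable_compose[OF ms f] by simp
  also have "\<dots> = (\<integral>\<^sup>+X. f (\<Sum>i\<in>K. (X (h i))\<^sup>2) \<partial>gauss I)"
    using sum.reindex_bij_betw[OF b, of "\<lambda>i. (X (h i))\<^sup>2" for X :: "_ \<Rightarrow> real"] by simp
  finally show ?thesis by simp
qed

lemma AE_std_normal_nonzero: "AE x in std_normal. x \<noteq> 0"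
  unfolding std_normal_def using AE_lborel_singleton[of "0::real"] by (subst AE_density) auto

lemma AE_chi_square_pos:
  assumes "1 \<le> d" shows "AE y in chi_square d. 0 < y"
proof -
  have m: "(\<lambda>x. \<Sum>i<d. (x i)\<^sup>2) \<in> gauss {..<d} \<rightarrow>\<^sub>M borel"
    using sum_squares_measurable[of "\<lambda>i. i" "{..<d}" "{..<d}"] by simp
  have "AE x in gauss {..<d}. x 0 \<noteq> 0"
    using assms by (intro AE_PiM_component[where P="\<lambda>x. x \<noteq> 0"] prob_space_std_normal AE_std_normal_nonzero) auto
  then have "AE x in gauss {..<d}. 0 < (\<Sum>i<d. (x i)\<^sup>2)"
  proof eventually_elim
    case (elim x)
    then show ?case using assms by (intro sum_pos2[of _ 0]) auto
  qed
  then show ?thesis unfolding chi_square_def by (subst AE_distr_iff[OF m]) auto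
qed

text \<open>Finiteness of this moment makes \<open>E (\<chi>\<^sup>2\<^sub>d)\<^bsup>-1/2\<^esup>\<close> finite for \<open>d \<ge> 2\<close>, through
  \<open>x\<^sup>2 + y\<^sup>2 \<ge> \<bar>x\<bar> \<bar>y\<bar>\<close>.\<close>

lemma nn_integral_abs_powr_std_normal_finite:
  "(\<integral>\<^sup>+x. ennreal (\<bar>x\<bar> powr (-1/2)) \<partial>std_normal) < \<infinity>"
proof -
  let ?f = "\<lambda>x::real. ennreal (x powr (-1/2)) * indicator {0..1} x"
  have one: "(\<integral>\<^sup>+x. ?f x \<partial>lborel) = ennreal 2"
    using nn_integral_has_integral_lebesgue'[OF _ has_integral_powr_from_0[of "-1/2" 1]] by simp
  have two: "(\<integral>\<^sup>+x. ?f (- x) \<partial>lborel) = ennreal 2"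
    using nn_integral_real_affine[of ?f "-1" 0] one by simp
  have d1: "std_normal_density x \<le> 1" for x
  proof -
    have "1 / sqrt (2 * pi) \<le> 1" using pi_ge_two by simp
    moreover have "exp (- x\<^sup>2 / 2) \<le> 1" by simp
    ultimately show ?thesis unfolding std_normal_density_def by (intro mult_le_one) auto
  qed
  have "(\<integral>\<^sup>+x. ennreal (\<bar>x\<bar> powr (-1/2)) \<partial>std_normal) =
      (\<integral>\<^sup>+x. ennreal (std_normal_density x) * ennreal (\<bar>x\<bar> powr (-1/2)) \<partial>lborel)"
    unfolding std_normal_def by (rule nn_integral_density) measurable
  also have "\<dots> \<le> (\<integral>\<^sup>+x. ennreal (std_normal_density x) + (?f x + ?f (- x)) \<partial>lborel)"
  proof (rule nn_integral_mono)
    fix x :: real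
    show "ennreal (std_normal_density x) * ennreal (\<bar>x\<bar> powr (-1/2)) \<le>
      ennreal (std_normal_density x) + (?f x + ?f (- x))"
    proof (cases "\<bar>x\<bar> \<le> 1")
      case True
      have "ennreal (std_normal_density x) * ennreal (\<bar>x\<bar> powr (-1/2)) \<le> 1 * ennreal (\<bar>x\<bar> powr (-1/2))"
        using d1[of x] by (intro mult_right_mono) (auto simp flip: ennreal_1 intro: ennreal_leI)
      also have "\<dots> \<le> ?f x + ?f (- x)"
        using True by (cases "0 \<le> x") (auto simp: abs_if)
      finally show ?thesis by (simp add: add_increasing)
    next
      case False
      then have "\<bar>x\<bar> powr (-1/2) \<le> 1" using powr_mono2'[of "-1/2" 1 "\<bar>x\<bar>"] by simp
      then have "ennreal (std_normal_density x) * ennreal (\<bar>x\<bar> powr (-1/2)) \<le> ennreal (std_normal_density x) * 1"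
        by (intro mult_left_mono) (auto simp flip: ennreal_1 intro: ennreal_leI)
      then show ?thesis by (simp add: add_increasing2)
    qed
  qed
  also have "\<dots> = (\<integral>\<^sup>+x. ennreal (std_normal_density x) \<partial>lborel) + ((\<integral>\<^sup>+x. ?f x \<partial>lborel) + (\<integral>\<^sup>+x. ?f (- x) \<partial>lborel))"
    by (subst nn_integral_add; (subst nn_integral_add)?; measurable)
  also have "(\<integral>\<^sup>+x. ennreal (std_normal_density x) \<partial>lborel) = 1"
    using std_normal.emeasure_space_1 by (simp add: std_normal_def emeasure_density)
  finally show ?thesis unfolding one two by (simp add: top.not_eq_extremum le_less_trans)
qed

text \<open>The integrability proved here is what licenses reading the Bochner integral \<open>\<gamma>_chi d\<close> as the true
  expectation; for \<open>d = 1\<close> the left-hand side is infinite.\<close>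

lemma nn_integral_inverse_chi:
  assumes d: "2 \<le> d"
  shows "(\<integral>\<^sup>+y. ennreal (1 / sqrt y) \<partial>chi_square d) = ennreal (\<gamma>_chi d)"
proof -
  define f where "f i = (if i < 2 then \<lambda>x. ennreal (\<bar>x\<bar> powr (-1/2)) else (\<lambda>x. 1))" for i :: nat
  have fm: "f i \<in> borel_measurable std_normal" for i by (simp add: f_def)
  have AE2: "AE x in gauss {..<d}. x 0 \<noteq> 0 \<and> x 1 \<noteq> 0"
    using d by (intro AE_conjI; intro AE_PiM_component[where P="\<lambda>x. x \<noteq> 0"] prob_space_std_normal AE_std_normal_nonzero) auto
  have "(\<integral>\<^sup>+y. ennreal (1 / sqrt y) \<partial>chi_square d) = (\<integral>\<^sup>+x. ennreal (1 / sqrt (\<Sum>i<d. (x i)\<^sup>2)) \<partial>gauss {..<d})"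
    using nn_integral_chi_square[of "{..<d}" "\<lambda>i. i" "{..<d}" "\<lambda>y. ennreal (1 / sqrt y)"] by simp
  also have "\<dots> \<le> (\<integral>\<^sup>+x. (\<Prod>i<d. f i (x i)) \<partial>gauss {..<d})"
  proof (rule nn_integral_mono_AE)
    show "AE x in gauss {..<d}. ennreal (1 / sqrt (\<Sum>i<d. (x i)\<^sup>2)) \<le> (\<Prod>i<d. f i (x i))"
      using AE2
    proof eventually_elim
      case (elim x)
      let ?u = "\<bar>x 0\<bar>" and ?v = "\<bar>x 1\<bar>"
      have uv: "0 < ?u" "0 < ?v" using elim by auto
      have "(\<Sum>i<2. (x i)\<^sup>2) \<le> (\<Sum>i<d. (x i)\<^sup>2)" using d by (intro sum_mono2) auto
      then have s: "(x 0)\<^sup>2 + (x 1)\<^sup>2 \<le> (\<Sum>i<d. (x i)\<^sup>2)" by (simp add: numeral_2_eq_2)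
      have "2 * (?u * ?v) \<le> (x 0)\<^sup>2 + (x 1)\<^sup>2"
        using sum_squares_bound[of ?u ?v] by (simp only: mult.assoc power2_abs)
      moreover have "0 < ?u * ?v" by (rule mult_pos_pos[OF uv])
      ultimately have "?u * ?v \<le> (\<Sum>i<d. (x i)\<^sup>2)" using s by linarith
      then have "1 / sqrt (\<Sum>i<d. (x i)\<^sup>2) \<le> 1 / sqrt (?u * ?v)"
        using real_sqrt_gt_zero[OF \<open>0 < ?u * ?v\<close>]
        by (intro frac_le real_sqrt_le_mono) simp_all
      also have "\<dots> = ?u powr (-1/2) * ?v powr (-1/2)"
        using uv by (simp add: powr_minus_divide powr_half_sqrt real_sqrt_mult)
      finally have "ennreal (1 / sqrt (\<Sum>i<d. (x i)\<^sup>2)) \<le> ennreal (?u powr (-1/2)) * ennreal (?v powr (-1/2))"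
        by (simp add: ennreal_mult[symmetric] ennreal_leI)
      also have "\<dots> = (\<Prod>i<2. f i (x i))" by (simp add: f_def numeral_2_eq_2)
      also have "\<dots> = (\<Prod>i<d. f i (x i))" using d by (intro prod.mono_neutral_left) (auto simp: f_def)
      finally show ?case .
    qed
  qed
  also have "\<dots> = (\<Prod>i<d. integral\<^sup>N std_normal (f i))"
    by (rule gauss.product_nn_integral_prod) (auto simp: fm)
  also have "\<dots> < \<infinity>"
  proof -
    have "integral\<^sup>N std_normal (f i) \<noteq> \<infinity>" for i
      using nn_integral_abs_powr_std_normal_finite std_normal.emeasure_space_1
      by (auto simp: f_def less_top)
    then show ?thesis by (simp add: less_top[symmetric] ennreal_prod_eq_top)
  qed
  finally have fin: "(\<integral>\<^sup>+y. ennreal (1 / sqrt y) \<partial>chi_square d) < \<infinity>" .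
  have pos: "AE y in chi_square d. 0 < y" using d by (intro AE_chi_square_pos) auto
  have "AE y in chi_square d. 0 \<le> 1 / sqrt y" using pos by eventually_elim auto
  moreover have "integrable (chi_square d) (\<lambda>y. 1 / sqrt y)"
    using fin calculation by (intro integrableI_nonneg) auto
  ultimately have "(\<integral>\<^sup>+y. ennreal (1 / sqrt y) \<partial>chi_square d) = ennreal (\<integral>y. 1 / sqrt y \<partial>chi_square d)"
    by (intro nn_integral_eq_integral)
  also have "(\<integral>y. 1 / sqrt y \<partial>chi_square d) = \<gamma>_chi d"
    unfolding \<gamma>_chi_def
  proof (rule integral_cong_AE)
    show "AE y in chi_square d. 1 / sqrt y = y powr (-1/2)"
      using pos by eventually_elim (simp add: powr_minus_divide powr_half_sqrt)
  qed auto
  finally show ?thesis .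
qed

lemma nn_integral_lborel_scale:
  fixes f :: "real \<Rightarrow> ennreal"
  assumes "f \<in> borel_measurable borel" "0 < c"
  shows "(\<integral>\<^sup>+t. f (t * c) \<partial>lborel) = ennreal (1 / c) * (\<integral>\<^sup>+t. f t \<partial>lborel)"
proof -
  have "ennreal (1 / c) * (\<integral>\<^sup>+t. f t \<partial>lborel) = ennreal (1 / c) * (ennreal c * (\<integral>\<^sup>+t. f (t * c) \<partial>lborel))"
    using nn_integral_real_affine[of f c 0] assms by (simp add: mult.commute)
  also have "\<dots> = ennreal (1 / c * c) * (\<integral>\<^sup>+t. f (t * c) \<partial>lborel)"
    using assms(2) by (subst ennreal_mult) (auto simp: mult.assoc)
  finally show ?thesis using assms(2) by simp
qed

definition cf_L1 :: "(nat \<times> nat) set \<Rightarrow> nat set \<Rightarrow> nat set \<Rightarrow> ennreal" where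
  "cf_L1 I R V = (\<integral>\<^sup>+t. ennreal (norm (cf I R V t)) \<partial>lborel)"

text \<open>The squared length of column \<open>p\<close> and that of row \<open>e\<close> on the other columns involve disjoint sets of
  entries, which makes them independent chi-square variables.\<close>

lemma cf_step:
  assumes fin: "finite I" "finite R" "finite V" and sub: "R \<times> V \<subseteq> I"
    and e: "e \<in> R" "R \<noteq> {e}" and pq: "p \<in> V" "q \<in> V - {p}" "V \<noteq> {p, q}"
  shows "ennreal (norm (cf I R V t)) \<le> (\<integral>\<^sup>+y. \<integral>\<^sup>+w.
    ennreal (norm (cf I (R - {e}) (V - {p, q}) (t * sqrt y * sqrt w))) \<partial>chi_square (card V - 1) \<partial>chi_square (card R))"
proof -
  interpret C: prob_space "chi_square (card V - 1)" by (rule prob_space_chi_square)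
  let ?c = "cf I (R - {e}) (V - {p, q})"
  have [measurable]: "?c \<in> borel_measurable borel" using sub by (intro cf_measurable) auto
  let ?F = "\<lambda>y. \<integral>\<^sup>+w. ennreal (norm (?c (t * sqrt y * sqrt w))) \<partial>chi_square (card V - 1)"
  have Fm: "?F \<in> borel_measurable borel" by measurable
  have row: "ennreal (norm (\<integral>X. iexp (t * gram_haf R V (with_col p (axis_vec e (sqrt y)) X)) \<partial>gauss I)) \<le> ?F y" for y
  proof -
    have "ennreal (norm (\<integral>X. iexp (t * gram_haf R V (with_col p (axis_vec e (sqrt y)) X)) \<partial>gauss I)) \<le>
      (\<integral>\<^sup>+Z. ennreal (norm (?c (t * sqrt y * sqrt (\<Sum>j\<in>V - {p}. (Z (e, j))\<^sup>2)))) \<partial>gauss I)"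
      by (rule cf_axis_le_row[OF fin sub pq(1) e(1) pq(2,3)])
    also have "\<dots> = (\<integral>\<^sup>+w. ennreal (norm (?c (t * sqrt y * sqrt w))) \<partial>chi_square (card (V - {p})))"
      using fin sub e by (intro nn_integral_chi_square[where f="\<lambda>w. ennreal (norm (?c (t * sqrt y * sqrt w)))"])
        (auto simp: inj_on_def)
    finally show ?thesis using fin pq by simp
  qed
  have "ennreal (norm (cf I R V t)) \<le> (\<integral>\<^sup>+Z. ennreal (norm
    (\<integral>X. iexp (t * gram_haf R V (with_col p (axis_vec e (sqrt (\<Sum>i\<in>R. (Z (i, p))\<^sup>2))) X)) \<partial>gauss I)) \<partial>gauss I)"
    by (rule cf_le_col[OF fin(1,2) sub pq(1) e])
  also have "\<dots> \<le> (\<integral>\<^sup>+Z. ?F (\<Sum>i\<in>R. (Z (i, p))\<^sup>2) \<partial>gauss I)" by (intro nn_integral_mono row)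
  also have "\<dots> = (\<integral>\<^sup>+y. ?F y \<partial>chi_square (card R))"
    using fin sub pq Fm by (intro nn_integral_chi_square[where f="?F"]) (auto simp: inj_on_def)
  finally show ?thesis .
qed

lemma cf_L1_step:
  assumes fin: "finite I" "finite R" "finite V" and sub: "R \<times> V \<subseteq> I"
    and e: "e \<in> R" "2 \<le> card R" and pq: "p \<in> V" "q \<in> V - {p}" "3 \<le> card V"
  shows "cf_L1 I R V \<le> ennreal (\<gamma>_chi (card R)) * ennreal (\<gamma>_chi (card V - 1)) * cf_L1 I (R - {e}) (V - {p, q})"
proof -
  let ?k = "chi_square (card R)" and ?l = "chi_square (card V - 1)"
  interpret C: prob_space ?k by (rule prob_space_chi_square)
  interpret D: prob_space ?l by (rule prob_space_chi_square)
  interpret P: pair_sigma_finite lborel ?k ..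
  interpret Q: pair_sigma_finite lborel ?l ..
  let ?c = "cf I (R - {e}) (V - {p, q})"
  have [measurable]: "?c \<in> borel_measurable borel" using sub by (intro cf_measurable) auto
  let ?J = "cf_L1 I (R - {e}) (V - {p, q})"
  have Re: "R \<noteq> {e}" using e by auto
  have Vpq: "V \<noteq> {p, q}" using pq card_insert_le_m1 by (auto simp: card_insert_if split: if_splits)
  have "cf_L1 I R V \<le> (\<integral>\<^sup>+t. \<integral>\<^sup>+y. \<integral>\<^sup>+w. ennreal (norm (?c (t * sqrt y * sqrt w))) \<partial>?l \<partial>?k \<partial>lborel)"
    unfolding cf_L1_def by (intro nn_integral_mono cf_step fin sub e(1) Re pq(1,2) Vpq)
  also have "\<dots> = (\<integral>\<^sup>+y. \<integral>\<^sup>+t. \<integral>\<^sup>+w. ennreal (norm (?c (t * sqrt y * sqrt w))) \<partial>?l \<partial>lborel \<partial>?k)"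
    by (rule P.Fubini'[symmetric]) measurable
  also have "\<dots> = (\<integral>\<^sup>+y. \<integral>\<^sup>+w. \<integral>\<^sup>+t. ennreal (norm (?c (t * sqrt y * sqrt w))) \<partial>lborel \<partial>?l \<partial>?k)"
    by (intro nn_integral_cong Q.Fubini'[symmetric]) measurable
  also have "\<dots> = (\<integral>\<^sup>+y. \<integral>\<^sup>+w. ennreal (1 / sqrt y) * (ennreal (1 / sqrt w) * ?J) \<partial>?l \<partial>?k)"
  proof (rule nn_integral_cong_AE)
    have posk: "AE y in ?k. 0 < y" using e by (intro AE_chi_square_pos) auto
    have posl: "AE w in ?l. 0 < w" using pq by (intro AE_chi_square_pos) auto
    show "AE y in ?k. (\<integral>\<^sup>+w. \<integral>\<^sup>+t. ennreal (norm (?c (t * sqrt y * sqrt w))) \<partial>lborel \<partial>?l) =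
      (\<integral>\<^sup>+w. ennreal (1 / sqrt y) * (ennreal (1 / sqrt w) * ?J) \<partial>?l)"
      using posk
    proof eventually_elim
      case y: (elim y)
      show ?case
      proof (rule nn_integral_cong_AE)
        show "AE w in ?l. (\<integral>\<^sup>+t. ennreal (norm (?c (t * sqrt y * sqrt w))) \<partial>lborel) =
            ennreal (1 / sqrt y) * (ennreal (1 / sqrt w) * ?J)"
          using posl
        proof eventually_elim
          case (elim w)
          have "(\<integral>\<^sup>+t. ennreal (norm (?c (t * (sqrt y * sqrt w)))) \<partial>lborel) = ennreal (1 / (sqrt y * sqrt w)) * ?J"
            unfolding cf_L1_def using elim y
            by (intro nn_integral_lborel_scale[where f="\<lambda>t. ennreal (norm (?c t))"]) auto
          also have "ennreal (1 / (sqrt y * sqrt w)) = ennreal (1 / sqrt y) * ennreal (1 / sqrt w)"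
            using elim y by (subst ennreal_mult[symmetric]) auto
          finally show ?case by (simp add: mult.assoc)
        qed
      qed
    qed
  qed
  also have "\<dots> = (\<integral>\<^sup>+y. ennreal (1 / sqrt y) * ((\<integral>\<^sup>+w. ennreal (1 / sqrt w) \<partial>?l) * ?J) \<partial>?k)"
    by (intro nn_integral_cong) (simp add: nn_integral_cmult nn_integral_multc)
  also have "\<dots> = (\<integral>\<^sup>+y. ennreal (1 / sqrt y) \<partial>?k) * ((\<integral>\<^sup>+w. ennreal (1 / sqrt w) \<partial>?l) * ?J)"
    by (rule nn_integral_multc) measurable
  also have "\<dots> = ennreal (\<gamma>_chi (card R)) * ennreal (\<gamma>_chi (card V - 1)) * ?J"
    using e pq by (simp add: nn_integral_inverse_chi mult.assoc)
  finally show ?thesis .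
qed

lemma gauss_exp_integral:
  assumes "0 < \<rho>"
  shows "(\<integral>\<^sup>+t. ennreal (exp (- (t * \<rho>)\<^sup>2 / 2)) \<partial>lborel) = ennreal (sqrt (2 * pi)) * ennreal (1 / \<rho>)"
proof -
  have 1: "(\<integral>\<^sup>+x. ennreal (std_normal_density x) \<partial>lborel) = 1"
    using std_normal.emeasure_space_1 by (simp add: std_normal_def emeasure_density)
  have "exp (- x\<^sup>2 / 2) = sqrt (2 * pi) * std_normal_density x" for x
    by (simp add: std_normal_density_def)
  then have "(\<integral>\<^sup>+x. ennreal (exp (- x\<^sup>2 / 2)) \<partial>lborel) =
      (\<integral>\<^sup>+x. ennreal (sqrt (2 * pi)) * ennreal (std_normal_density x) \<partial>lborel)"
    by (simp add: ennreal_mult)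
  also have "\<dots> = ennreal (sqrt (2 * pi))" by (subst nn_integral_cmult) (auto simp: 1)
  finally show ?thesis
    using nn_integral_lborel_scale[of "\<lambda>x. ennreal (exp (- x\<^sup>2 / 2))" \<rho>] assms by (simp add: mult.commute)
qed

text \<open>For two columns, rotating \<open>p\<close> to \<open>\<rho> e\<close> leaves \<open>\<rho>\<close> times one standard normal entry, with
  characteristic function \<open>exp(- (t \<rho>)\<^sup>2/2)\<close>. Here \<open>cf_step\<close> would be useless: the hafnian of the
  empty matrix is the constant \<open>1\<close>, whose characteristic function is not integrable.\<close>

lemma cf_L1_base:
  assumes fin: "finite I" "finite R" and pq: "p \<noteq> q" and sub: "R \<times> {p, q} \<subseteq> I" and R: "2 \<le> card R"
  shows "cf_L1 I R {p, q} \<le> ennreal (sqrt (2 * pi)) * ennreal (\<gamma>_chi (card R))"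
proof -
  let ?k = "chi_square (card R)"
  interpret C: prob_space ?k by (rule prob_space_chi_square)
  interpret P: pair_sigma_finite lborel ?k ..
  obtain e where e: "e \<in> R" using R by fastforce
  have Re: "R \<noteq> {e}" using R by auto
  have axis: "norm (\<integral>X. iexp (t * gram_haf R {p, q} (with_col p (axis_vec e \<rho>) X)) \<partial>gauss I) =
      exp (- (t * \<rho>)\<^sup>2 / 2)" for t \<rho>
  proof -
    have "gram_haf R {p, q} (with_col p (axis_vec e \<rho>) X) = \<rho> * X (e, q)" for X
      using gram_haf_pivot[of "{p, q}" R e p q "with_col p (axis_vec e \<rho>) X"] fin e pq
      by (simp add: with_col_def axis_vec_def gram_haf_def)
    then have "(\<integral>X. iexp (t * gram_haf R {p, q} (with_col p (axis_vec e \<rho>) X)) \<partial>gauss I) =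
        (\<integral>X. iexp (t * \<rho> * X (e, q)) \<partial>gauss I)" by (simp add: mult.assoc)
    also have "\<dots> = (\<integral>x. iexp (t * \<rho> * x) \<partial>distr (gauss I) std_normal (\<lambda>X. X (e, q)))"
      using e sub by (intro integral_distr[symmetric] measurable_component_singleton) auto
    also have "distr (gauss I) std_normal (\<lambda>X. X (e, q)) = std_normal"
      using e sub prob_space_std_normal by (intro distr_PiM_component) auto
    also have "(\<integral>x. iexp (t * \<rho> * x) \<partial>std_normal) = char std_normal_distribution (t * \<rho>)"
      by (simp add: char_def std_normal_def)
    finally show ?thesis by (simp add: char_std_normal_distribution)
  qed
  have "ennreal (norm (cf I R {p, q} t)) \<le> (\<integral>\<^sup>+y. ennreal (exp (- (t * sqrt y)\<^sup>2 / 2)) \<partial>?k)" for t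
  proof -
    have "ennreal (norm (cf I R {p, q} t)) \<le> (\<integral>\<^sup>+Z. ennreal (exp (- (t * sqrt (\<Sum>i\<in>R. (Z (i, p))\<^sup>2))\<^sup>2 / 2)) \<partial>gauss I)"
      using cf_le_col[OF fin sub _ e Re, of p t] by (simp only: axis insert_iff simp_thms)
    also have "\<dots> = (\<integral>\<^sup>+y. ennreal (exp (- (t * sqrt y)\<^sup>2 / 2)) \<partial>?k)"
      using fin sub by (intro nn_integral_chi_square[where f="\<lambda>y. ennreal (exp (- (t * sqrt y)\<^sup>2 / 2))"])
        (auto simp: inj_on_def)
    finally show ?thesis .
  qed
  then have "cf_L1 I R {p, q} \<le> (\<integral>\<^sup>+t. \<integral>\<^sup>+y. ennreal (exp (- (t * sqrt y)\<^sup>2 / 2)) \<partial>?k \<partial>lborel)"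
    unfolding cf_L1_def by (rule nn_integral_mono)
  also have "\<dots> = (\<integral>\<^sup>+y. \<integral>\<^sup>+t. ennreal (exp (- (t * sqrt y)\<^sup>2 / 2)) \<partial>lborel \<partial>?k)"
    by (rule P.Fubini'[symmetric]) measurable
  also have "\<dots> = (\<integral>\<^sup>+y. ennreal (sqrt (2 * pi)) * ennreal (1 / sqrt y) \<partial>?k)"
  proof (rule nn_integral_cong_AE)
    have "AE y in ?k. 0 < y" using R by (intro AE_chi_square_pos) auto
    then show "AE y in ?k. (\<integral>\<^sup>+t. ennreal (exp (- (t * sqrt y)\<^sup>2 / 2)) \<partial>lborel) = ennreal (sqrt (2 * pi)) * ennreal (1 / sqrt y)"
      by eventually_elim (rule gauss_exp_integral, simp)
  qed
  also have "\<dots> = ennreal (sqrt (2 * pi)) * ennreal (\<gamma>_chi (card R))"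
    using R by (subst nn_integral_cmult) (auto simp: nn_integral_inverse_chi)
  finally show ?thesis .
qed

lemma \<gamma>_chi_nonneg: "0 \<le> \<gamma>_chi d"
  unfolding \<gamma>_chi_def by (intro Bochner_Integration.integral_nonneg) simp

text \<open>Each step lowers the number of rows by one and that of columns by two, so the degrees of freedom
  run through \<open>k, k - 1, \<dots>\<close> and \<open>2n - 1, 2n - 3, \<dots>\<close>. The condition \<open>n + 1 \<le> card R\<close> keeps the
  former at least \<open>2\<close>, where \<open>\<gamma>\<close> is finite.\<close>

lemma cf_L1_le:
  assumes fin: "finite I" and n: "1 \<le> n"
  shows "finite R \<Longrightarrow> finite V \<Longrightarrow> R \<times> V \<subseteq> I \<Longrightarrow> card V = 2 * n \<Longrightarrow> n + 1 \<le> card R \<Longrightarrow>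
    cf_L1 I R V \<le> ennreal (sqrt (2 * pi) * ((\<Prod>j<n. \<gamma>_chi (card R - j)) * (\<Prod>r=2..n. \<gamma>_chi (2 * r - 1))))"
  using n
proof (induction n arbitrary: R V rule: nat_induct_at_least)
  case base
  then obtain p q where V: "V = {p, q}" "p \<noteq> q" by (auto simp: card_2_iff)
  have "cf_L1 I R V \<le> ennreal (sqrt (2 * pi)) * ennreal (\<gamma>_chi (card R))"
    unfolding V(1) using base V by (intro cf_L1_base fin) auto
  then show ?case by (simp add: ennreal_mult \<gamma>_chi_nonneg)
next
  case (Suc n)
  obtain e where e: "e \<in> R" using Suc.prems by fastforce
  obtain p where p: "p \<in> V" using Suc.prems by fastforce
  have "card (V - {p}) \<noteq> 0" using Suc.prems p by simp
  then obtain q where q: "q \<in> V - {p}" by (metis card.empty ex_in_conv)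
  have cR: "card (R - {e}) = card R - 1" using e Suc.prems by simp
  have "card (V - {p, q}) = card V - 2" using p q Suc.prems by (subst card_Diff_subset) auto
  then have cV: "card (V - {p, q}) = 2 * n" using Suc.prems by simp
  let ?A = "\<Prod>j<n. \<gamma>_chi (card R - 1 - j)" and ?B = "\<Prod>r=2..n. \<gamma>_chi (2 * r - 1)"
  have A0: "0 \<le> ?A" "0 \<le> ?B" by (auto intro!: prod_nonneg \<gamma>_chi_nonneg)
  have IH: "cf_L1 I (R - {e}) (V - {p, q}) \<le> ennreal (sqrt (2 * pi) * (?A * ?B))"
  proof -
    have "(R - {e}) \<times> (V - {p, q}) \<subseteq> I" using Suc.prems by auto
    then show ?thesis using Suc.IH[of "R - {e}" "V - {p, q}"] Suc.prems cV by (simp add: cR)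
  qed
  have "cf_L1 I R V \<le> ennreal (\<gamma>_chi (card R)) * ennreal (\<gamma>_chi (card V - 1)) * cf_L1 I (R - {e}) (V - {p, q})"
    using Suc.prems Suc.hyps e p q by (intro cf_L1_step fin) auto
  also have "\<dots> \<le> ennreal (\<gamma>_chi (card R)) * ennreal (\<gamma>_chi (card V - 1)) * ennreal (sqrt (2 * pi) * (?A * ?B))"
    by (intro mult_left_mono IH) auto
  also have "\<dots> = ennreal (\<gamma>_chi (card R) * \<gamma>_chi (card V - 1) * (sqrt (2 * pi) * (?A * ?B)))"
    using A0 by (simp add: ennreal_mult \<gamma>_chi_nonneg)
  also have "\<gamma>_chi (card R) * \<gamma>_chi (card V - 1) * (sqrt (2 * pi) * (?A * ?B)) =
      sqrt (2 * pi) * ((\<Prod>j<Suc n. \<gamma>_chi (card R - j)) * (\<Prod>r=2..Suc n. \<gamma>_chi (2 * r - 1)))"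
  proof -
    have "(\<Prod>j<Suc n. \<gamma>_chi (card R - j)) = \<gamma>_chi (card R) * ?A"
      by (subst prod.lessThan_Suc_shift) simp
    moreover have "(\<Prod>r=2..Suc n. \<gamma>_chi (2 * r - 1)) = ?B * \<gamma>_chi (card V - 1)"
      using Suc.hyps Suc.prems by (simp add: prod.nat_ivl_Suc')
    ultimately show ?thesis by simp
  qed
  finally show ?case .
qed

section \<open>Small balls\<close>

lemma (in real_distribution) interval_le_char_integral:
  assumes ab: "a \<le> b" and atoms: "measure M {a} = 0" "measure M {b} = 0"
    and J: "(\<integral>\<^sup>+t. ennreal (norm (char M t)) \<partial>lborel) \<le> ennreal J" "0 \<le> J"
  shows "measure M {a<..b} \<le> (b - a) * J / (2 * pi)"
proof -
  let ?g = "\<lambda>t. (iexp (-(t * a)) - iexp (-(t * b))) / (\<i> * t) * char M t"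
  have [measurable]: "char M \<in> borel_measurable borel" by simp
  have mg: "?g \<in> borel_measurable borel" by measurable
  have le: "norm (?g t) \<le> (b - a) * norm (char M t)" if "t \<noteq> 0" for t
  proof -
    have "cmod ((iexp (t * (- a)) - iexp (t * (- b))) / (\<i> * t)) \<le> - a - - b"
      using ab that by (intro Levy_Inversion_aux2) auto
    then show ?thesis unfolding norm_mult by (intro mult_right_mono) auto
  qed
  have bd: "norm (1 / (2 * pi) * (CLBINT t=-ereal T..ereal T. ?g t)) \<le> (b - a) * J / (2 * pi)" if "0 \<le> T" for T
  proof -
    have "ennreal (norm (CLBINT t=-ereal T..ereal T. ?g t)) \<le> ennreal ((b - a) * J)"
    proof (cases "integrable lborel (\<lambda>t. indicator (einterval (-ereal T) (ereal T)) t *\<^sub>R ?g t)")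
      case True
      have "(CLBINT t=-ereal T..ereal T. ?g t) = (\<integral>t. indicator (einterval (-ereal T) (ereal T)) t *\<^sub>R ?g t \<partial>lborel)"
        using that by (simp add: interval_lebesgue_integral_le_eq set_lebesgue_integral_def)
      then have "ennreal (norm (CLBINT t=-ereal T..ereal T. ?g t)) \<le>
          (\<integral>\<^sup>+t. ennreal (norm (indicator (einterval (-ereal T) (ereal T)) t *\<^sub>R ?g t)) \<partial>lborel)"
        using integral_norm_bound_ennreal[OF True] by simp
      also have "\<dots> \<le> (\<integral>\<^sup>+t. ennreal (b - a) * ennreal (norm (char M t)) \<partial>lborel)"
      proof (rule nn_integral_mono_AE)
        show "AE t in lborel. ennreal (norm (indicator (einterval (-ereal T) (ereal T)) t *\<^sub>R ?g t)) \<le>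
          ennreal (b - a) * ennreal (norm (char M t))"
          using AE_lborel_singleton[of 0]
        proof eventually_elim
          case (elim t)
          have "norm (indicator (einterval (-ereal T) (ereal T)) t *\<^sub>R ?g t) \<le> norm (?g t)"
            by (simp add: indicator_def)
          also note le[OF elim]
          finally show ?case using ab by (simp add: ennreal_mult[symmetric] ennreal_leI)
        qed
      qed
      also have "\<dots> = ennreal (b - a) * (\<integral>\<^sup>+t. ennreal (norm (char M t)) \<partial>lborel)"
        by (rule nn_integral_cmult) measurable
      also have "\<dots> \<le> ennreal (b - a) * ennreal J" by (intro mult_left_mono J) auto
      finally show ?thesis using ab J by (simp add: ennreal_mult)
    next
      case False
      then show ?thesis
        using that ab J by (simp add: interval_lebesgue_integral_le_eq set_lebesgue_integral_def not_integrable_integral_eq)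
    qed
    then have "norm (CLBINT t=-ereal T..ereal T. ?g t) \<le> (b - a) * J"
      using ab J by (subst (asm) ennreal_le_iff) auto
    then show ?thesis
      by (simp add: norm_mult norm_divide divide_simps)
  qed
  have endpoint: "ereal (real_of_int (- int T)) = - ereal (real T)" for T by simp
  have "(\<lambda>T. norm (1 / (2 * pi) * (CLBINT t=-ereal (real T)..ereal (real T). ?g t)))
     \<longlonglongrightarrow> norm (complex_of_real (measure M {a<..b}))"
    using Levy_Inversion[OF ab atoms, unfolded endpoint] by (rule tendsto_norm)
  moreover have "norm (1 / (2 * pi) * (CLBINT t=-ereal (real T)..ereal (real T). ?g t)) \<le> (b - a) * J / (2 * pi)" for T :: nat
    by (rule bd) simp
  ultimately have "norm (complex_of_real (measure M {a<..b})) \<le> (b - a) * J / (2 * pi)"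
    by (intro LIMSEQ_le_const2) auto
  then show ?thesis by simp
qed

text \<open>Levy's formula needs endpoints that are not atoms. Atoms are countable, so such endpoints exist
  just outside the interval, at arbitrarily small cost.\<close>

lemma (in real_distribution) small_ball_le_char_integral:
  assumes h: "0 \<le> h"
    and J: "(\<integral>\<^sup>+t. ennreal (norm (char M t)) \<partial>lborel) \<le> ennreal J" "0 \<le> J"
  shows "measure M {z - h..z + h} \<le> h * J / pi"
proof (rule field_le_epsilon)
  fix \<eta> :: real assume \<eta>: "0 < \<eta>"
  \<comment> \<open>Widening by \<open>d\<close> on both sides raises the bound by \<open>d J / \<pi> \<le> \<eta>\<close>.\<close>
  define d where "d = \<eta> * pi / (J + 1)"
  have d: "0 < d" using \<eta> J by (simp add: d_def)
  have ex: "\<exists>x. x \<in> {u<..<u + d} \<and> measure M {x} = 0" for u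
    using open_minus_countable[OF countable_support, of "{u<..<u + d}"] d by auto
  obtain a where a: "z - h - d < a" "a < z - h" "measure M {a} = 0" using ex[of "z - h - d"] by auto
  obtain b where b: "z + h < b" "b < z + h + d" "measure M {b} = 0" using ex[of "z + h"] by auto
  have "measure M {z - h..z + h} \<le> measure M {a<..b}"
    using a b by (intro finite_measure_mono) auto
  also have "\<dots> \<le> (b - a) * J / (2 * pi)"
    using a b h by (intro interval_le_char_integral J) auto
  also have "\<dots> \<le> (2 * h + 2 * d) * J / (2 * pi)"
    using a b J by (intro divide_right_mono mult_right_mono) auto
  also have "\<dots> = h * J / pi + d * J / pi" by (simp add: field_simps)
  also have "d * J / pi = \<eta> * (J / (J + 1))" by (simp add: d_def)
  also have "\<dots> \<le> \<eta> * 1" using \<eta> J by (intro mult_left_mono) auto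
  finally show "measure M {z - h..z + h} \<le> h * J / pi + \<eta>" by simp
qed

lemma gauss_gram_haf_small_ball:
  assumes n: "1 \<le> n" and k: "n + 1 \<le> k" and h: "0 \<le> h"
  defines "I \<equiv> {..<k} \<times> {..<2 * n}"
  shows "measure (gauss I) {X \<in> space (gauss I). \<bar>gram_haf {..<k} {..<2 * n} X - z\<bar> \<le> h} \<le>
    sqrt (2 / pi) * h * ((\<Prod>j<n. \<gamma>_chi (k - j)) * (\<Prod>r=2..n. \<gamma>_chi (2 * r - 1)))"
proof -
  interpret G: prob_space "gauss I" by (rule prob_space_gauss)
  let ?H = "gram_haf {..<k} {..<2 * n}"
  let ?P = "(\<Prod>j<n. \<gamma>_chi (k - j)) * (\<Prod>r=2..n. \<gamma>_chi (2 * r - 1))"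
  have H [measurable]: "?H \<in> borel_measurable (gauss I)"
    using gram_haf_measurable[of "{..<k}" "{..<2 * n}" "\<lambda>X. X" "gauss I"] gauss_component[of _ I]
    by (auto simp: I_def)
  interpret D: real_distribution "distr (gauss I) borel ?H" by (rule G.real_distribution_distr[OF H])
  have char: "char (distr (gauss I) borel ?H) t = cf I {..<k} {..<2 * n} t" for t
    unfolding char_def cf_def by (rule integral_distr[OF H]) measurable
  have P0: "0 \<le> ?P" by (intro mult_nonneg_nonneg prod_nonneg \<gamma>_chi_nonneg)
  have "(\<integral>\<^sup>+t. ennreal (norm (char (distr (gauss I) borel ?H) t)) \<partial>lborel) \<le> ennreal (sqrt (2 * pi) * ?P)"
    using cf_L1_le[of I n "{..<k}" "{..<2 * n}"] n k unfolding char cf_L1_def[symmetric] by (simp add: I_def)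
  then have "measure (distr (gauss I) borel ?H) {z - h..z + h} \<le> h * (sqrt (2 * pi) * ?P) / pi"
    using P0 by (intro D.small_ball_le_char_integral h) auto
  also have "\<dots> = sqrt (2 / pi) * h * ?P"
  proof -
    have "sqrt (2 * pi) / pi = sqrt (2 / pi)"
      by (simp add: real_sqrt_mult real_sqrt_divide field_simps)
    then show ?thesis by (simp add: field_simps)
  qed
  also have "measure (distr (gauss I) borel ?H) {z - h..z + h} =
      measure (gauss I) {X \<in> space (gauss I). \<bar>?H X - z\<bar> \<le> h}"
    by (subst measure_distr[OF H]) (auto intro!: arg_cong[where f="measure _"])
  finally show ?thesis .
qed


section \<open>Transfer to random matrices\<close>

lemma measure_le_tv_dist:
  assumes "prob_space \<mu>" "prob_space \<nu>" and A: "A \<in> sets \<mu>"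
  shows "measure \<mu> A \<le> measure \<nu> A + tv_dist \<mu> \<nu>"
proof -
  have "\<bar>measure \<mu> A - measure \<nu> A\<bar> \<le> tv_dist \<mu> \<nu>"
    unfolding tv_dist_def
  proof (rule cSUP_upper[OF A])
    have "\<bar>measure \<mu> B - measure \<nu> B\<bar> \<le> 1" for B
      using prob_space.prob_le_1[OF assms(1), of B] prob_space.prob_le_1[OF assms(2), of B]
        measure_nonneg[of \<mu> B] measure_nonneg[of \<nu> B] by linarith
    then show "bdd_above ((\<lambda>B. \<bar>measure \<mu> B - measure \<nu> B\<bar>) ` sets \<mu>)"
      by (intro bdd_aboveI[of _ 1]) auto
  qed
  then show ?thesis by linarith
qed

lemma space_mat_borel [simp]: "space (mat_borel k m) = carrier_mat k m"
  by (simp add: mat_borel_def)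

lemma mat_borel_entry:
  assumes "i < k" "j < m"
  shows "(\<lambda>A. A $$ (i, j)) \<in> borel_measurable (mat_borel k m)"
proof -
  have "(\<lambda>A. \<lambda>p\<in>{..<k} \<times> {..<m}. A $$ p) \<in> mat_borel k m \<rightarrow>\<^sub>M Pi\<^sub>M ({..<k} \<times> {..<m}) (\<lambda>_. borel)"
    unfolding mat_borel_def by (rule measurable_vimage_algebra1) (auto simp: space_PiM)
  from measurable_compose[OF this measurable_component_singleton[of "(i, j)"]] show ?thesis
    using assms by simp
qed

lemma measurable_mat_borelI:
  assumes "\<And>x. x \<in> space M \<Longrightarrow> F x \<in> carrier_mat k m"
    and "\<And>i j. i < k \<Longrightarrow> j < m \<Longrightarrow> (\<lambda>x. F x $$ (i, j)) \<in> borel_measurable M"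
  shows "F \<in> M \<rightarrow>\<^sub>M mat_borel k m"
  unfolding mat_borel_def
proof (rule measurable_vimage_algebra2)
  show "F \<in> space M \<rightarrow> carrier_mat k m" using assms(1) by auto
  show "(\<lambda>x. \<lambda>p\<in>{..<k} \<times> {..<m}. F x $$ p) \<in> M \<rightarrow>\<^sub>M Pi\<^sub>M ({..<k} \<times> {..<m}) (\<lambda>_. borel)"
    using assms(2) by (intro measurable_restrict) auto
qed

lemma haf_gram:
  assumes "A \<in> carrier_mat k m"
  shows "haf (transpose_mat A * A) = gram_haf {..<k} {..<m} (\<lambda>p. A $$ p)"
proof -
  have "dim_row (transpose_mat A * A) = m" using assms by auto
  then have "haf (transpose_mat A * A) = hafs {..<m} (\<lambda>a b. (transpose_mat A * A) $$ (a, b))"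
    by (simp add: haf_eq_hafs)
  also have "\<dots> = gram_haf {..<k} {..<m} (\<lambda>p. A $$ p)"
    unfolding gram_haf_def using assms
    by (intro hafs_cong) (auto simp: gram_def scalar_prod_def atLeast0LessThan)
  finally show ?thesis .
qed

lemma haf_smult:
  assumes "dim_row A = 2 * n" "dim_col A = 2 * n"
  shows "haf (c \<cdot>\<^sub>m A) = c ^ n * haf A"
proof -
  have "haf (c \<cdot>\<^sub>m A) = hafs {..<2 * n} (\<lambda>a b. c * A $$ (a, b))"
    unfolding haf_eq_hafs using assms by (simp, intro hafs_cong) auto
  also have "\<dots> = c ^ n * haf A"
    unfolding haf_eq_hafs using assms by (simp add: hafs_scale)
  finally show ?thesis .
qed

lemma haf_gram_measurable:
  "(\<lambda>A. haf (transpose_mat A * A)) \<in> borel_measurable (mat_borel k m)"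
proof -
  have "(\<lambda>A. gram_haf {..<k} {..<m} (\<lambda>p. A $$ p)) \<in> borel_measurable (mat_borel k m)"
    by (intro gram_haf_measurable mat_borel_entry) auto
  then show ?thesis
    by (rule measurable_cong[THEN iffD1, rotated]) (auto simp: haf_gram)
qed

lemma gauss_mat_measurable:
  "(\<lambda>x. Matrix.mat k m x) \<in> gauss ({..<k} \<times> {..<m}) \<rightarrow>\<^sub>M mat_borel k m"
  by (rule measurable_mat_borelI) (auto intro!: gauss_component)

lemma prob_space_gauss_mat: "prob_space (gauss_mat k m)"
  unfolding gauss_mat_def by (intro prob_space.prob_space_distr prob_space_gauss gauss_mat_measurable)

lemma gauss_mat_small_ball:
  assumes n: "1 \<le> n" and k: "n + 1 \<le> k" and e: "0 \<le> \<epsilon>"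
  shows "measure (gauss_mat k (2 * n)) {A \<in> carrier_mat k (2 * n).
      \<bar>haf (transpose_mat A * A) - z\<bar> \<le> \<epsilon> * \<sigma>_haf k n} \<le> min 1 (B_real k n * \<epsilon>)"
proof -
  interpret P: prob_space "gauss_mat k (2 * n)" by (rule prob_space_gauss_mat)
  let ?I = "{..<k} \<times> {..<2 * n}" and ?h = "\<epsilon> * \<sigma>_haf k n"
  let ?A = "{A \<in> carrier_mat k (2 * n). \<bar>haf (transpose_mat A * A) - z\<bar> \<le> ?h}"
  have h: "0 \<le> ?h" using e by (simp add: \<sigma>_haf_def)
  have "{A \<in> space (mat_borel k (2 * n)). \<bar>haf (transpose_mat A * A) - z\<bar> \<le> ?h} \<in> sets (mat_borel k (2 * n))"
    using haf_gram_measurable[of k "2 * n"] by measurable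
  then have A: "?A \<in> sets (mat_borel k (2 * n))" by simp
  have "measure (gauss_mat k (2 * n)) ?A = measure (gauss ?I) ((\<lambda>x. Matrix.mat k (2 * n) x) -` ?A \<inter> space (gauss ?I))"
    unfolding gauss_mat_def by (rule measure_distr[OF gauss_mat_measurable A])
  also have "(\<lambda>x. Matrix.mat k (2 * n) x) -` ?A \<inter> space (gauss ?I) =
      {X \<in> space (gauss ?I). \<bar>gram_haf {..<k} {..<2 * n} X - z\<bar> \<le> ?h}"
  proof -
    have "haf (transpose_mat (Matrix.mat k (2 * n) X) * Matrix.mat k (2 * n) X) = gram_haf {..<k} {..<2 * n} X" for X
      by (subst haf_gram[of _ k "2 * n"]) (auto intro!: gram_haf_cong)
    then show ?thesis by auto
  qed
  also have "measure (gauss ?I) \<dots> \<le>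
      sqrt (2 / pi) * ?h * ((\<Prod>j<n. \<gamma>_chi (k - j)) * (\<Prod>r=2..n. \<gamma>_chi (2 * r - 1)))"
    by (rule gauss_gram_haf_small_ball[OF n k h])
  also have "\<dots> = B_real k n * \<epsilon>" by (simp add: B_real_def)
  finally show ?thesis by (simp add: P.prob_le_1)
qed

theorem mainTheorem4:
  fixes M n K N :: "nat \<Rightarrow> nat"
    and r \<tau> :: real
    and P :: "nat \<Rightarrow> 'a measure"
    and U :: "nat \<Rightarrow> 'a \<Rightarrow> real mat"
    and S :: "nat \<Rightarrow> 'a \<Rightarrow> nat set"
    and enum :: "nat \<Rightarrow> nat set \<Rightarrow> nat \<Rightarrow> nat"
    and B BS OSK X :: "nat \<Rightarrow> 'a \<Rightarrow> real mat"
    and \<delta> :: "nat \<Rightarrow> real"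
  assumes M_lim: "filterlim M at_top sequentially"
    and n_ge: "\<And>i. 1 \<le> n i"
    and N_eq: "\<And>i. N i = 2 * n i"
    and K_ge: "\<And>i. n i + 1 \<le> K i"
    and K_less: "\<And>i. K i < M i"
    and NK_lim: "(\<lambda>i. real (N i * K i) / real (M i)) \<longlonglongrightarrow> 0"
    and prob: "\<And>i. prob_space (P i)"
    and U_meas: "\<And>i. U i \<in> measurable (P i) (orth_borel (M i))"
    and U_haar: "\<And>i. haar_orthogonal (M i) (distr (P i) (orth_borel (M i)) (U i))"
    (* a deterministic S is the special case of a constant (hence independent) S *)
    and S_meas: "\<And>i. S i \<in> measurable (P i) (count_space {s. s \<subseteq> {..<M i} \<and> card s = N i})"
    and US_indep: "\<And>i. prob_space.indep_set (P i)
        (sets (vimage_algebra (space (P i)) (U i) (orth_borel (M i))))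
        (sets (vimage_algebra (space (P i)) (S i) (count_space {s. s \<subseteq> {..<M i} \<and> card s = N i})))"
    (* an arbitrary ordering of each possible value of S *)
    and enum_bij: "\<And>i s. s \<subseteq> {..<M i} \<Longrightarrow> card s = N i \<Longrightarrow> bij_betw (enum i s) {..<N i} s"
    and r_pos: "0 < r"
    and \<tau>_eq: "\<tau> = tanh r"
    and B_eq: "\<And>i \<omega>. B i \<omega> = \<tau> \<cdot>\<^sub>m (U i \<omega> * proj_mat (M i) (K i) * transpose_mat (U i \<omega>))"
    and BS_eq: "\<And>i \<omega>. BS i \<omega> = Matrix.mat (N i) (N i)
        (\<lambda>(a, b). B i \<omega> $$ (enum i (S i \<omega>) a, enum i (S i \<omega>) b))"
    and OSK_eq: "\<And>i \<omega>. OSK i \<omega> = Matrix.mat (N i) (K i) (\<lambda>(a, b). U i \<omega> $$ (enum i (S i \<omega>) a, b))"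
    and X_eq: "\<And>i \<omega>. X i \<omega> = sqrt (real (M i)) \<cdot>\<^sub>m transpose_mat (OSK i \<omega>)"
    and \<delta>_eq: "\<And>i. \<delta> i = tv_dist (distr (P i) (mat_borel (K i) (N i)) (X i)) (gauss_mat (K i) (N i))"
  shows "\<forall>i. (\<forall>\<omega>\<in>space (P i). BS i \<omega> = (\<tau> / real (M i)) \<cdot>\<^sub>m (transpose_mat (X i \<omega>) * X i \<omega>)) \<and>
    (\<forall>\<epsilon>\<ge>0. (SUP z. measure (P i)
          {\<omega> \<in> space (P i). \<bar>haf (BS i \<omega>) - z\<bar> \<le> \<epsilon> * (\<tau> / real (M i)) ^ n i * \<sigma>_haf (K i) (n i)})
       \<le> min 1 (B_real (K i) (n i) * \<epsilon>) + \<delta> i)"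
proof (intro allI conjI ballI impI)
  fix i
  interpret P: prob_space "P i" by (rule prob)
  let ?m = "M i" and ?k = "K i" and ?N = "N i"
  have mpos: "0 < real ?m" using K_less[of i] by simp
  have tpos: "0 < \<tau>" using r_pos by (simp add: \<tau>_eq)
  have Uc: "U i \<omega> \<in> carrier_mat ?m ?m" if "\<omega> \<in> space (P i)" for \<omega>
    using measurable_space[OF U_meas that]
    by (auto simp: orth_borel_def space_restrict_space orthogonal_group_def)
  have Sc: "S i \<omega> \<subseteq> {..<?m}" "card (S i \<omega>) = ?N" if "\<omega> \<in> space (P i)" for \<omega>
    using measurable_space[OF S_meas that] by auto
  have en: "enum i s a < ?m" if "s \<subseteq> {..<?m}" "card s = ?N" "a < ?N" for s a
    using bij_betwE[OF enum_bij[OF that(1,2)]] that by auto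
  have Xc: "X i \<omega> \<in> carrier_mat ?k ?N" for \<omega> by (simp add: X_eq OSK_eq)
  have Xe: "X i \<omega> $$ (j, a) = sqrt ?m * U i \<omega> $$ (enum i (S i \<omega>) a, j)" if "j < ?k" "a < ?N" for \<omega> j a
    using that by (simp add: X_eq OSK_eq)
  show BX: "BS i \<omega> = (\<tau> / real ?m) \<cdot>\<^sub>m (transpose_mat (X i \<omega>) * X i \<omega>)" if w: "\<omega> \<in> space (P i)" for \<omega>
  proof (rule eq_matI)
    fix a b assume "a < dim_row ((\<tau> / real ?m) \<cdot>\<^sub>m (transpose_mat (X i \<omega>) * X i \<omega>))"
      "b < dim_col ((\<tau> / real ?m) \<cdot>\<^sub>m (transpose_mat (X i \<omega>) * X i \<omega>))"
    then have ab: "a < ?N" "b < ?N" using Xc[of \<omega>] by auto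
    let ?a = "enum i (S i \<omega>) a" and ?b = "enum i (S i \<omega>) b" and ?U = "U i \<omega>"
    have abm: "?a < ?m" "?b < ?m" using en Sc[OF w] ab by auto
    have pc: "proj_mat ?m ?k \<in> carrier_mat ?m ?m"
      using K_less[of i] by (auto simp: proj_mat_def diag_block_mat.simps Let_def)
    have pe: "proj_mat ?m ?k $$ (l, j) = (if l = j \<and> j < ?k then 1 else 0)" if "l < ?m" "j < ?m" for l j
      using that K_less[of i] by (auto simp: proj_mat_def diag_block_mat.simps Let_def)
    have UP: "(?U * proj_mat ?m ?k) $$ (?a, j) = (if j < ?k then ?U $$ (?a, j) else 0)" if j: "j < ?m" for j
    proof -
      have "(?U * proj_mat ?m ?k) $$ (?a, j) = (\<Sum>l\<in>{0..<?m}. ?U $$ (?a, l) * proj_mat ?m ?k $$ (l, j))"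
        using j abm Uc[OF w] pc by (simp add: scalar_prod_def)
      also have "\<dots> = (\<Sum>l\<in>{0..<?m}. if l = j then (if j < ?k then ?U $$ (?a, j) else 0) else 0)"
        using j by (intro sum.cong) (auto simp: pe)
      also have "\<dots> = (if j < ?k then ?U $$ (?a, j) else 0)" using j by (subst sum.delta) auto
      finally show ?thesis .
    qed
    have entry: "(W * transpose_mat ?U) $$ (?a, ?b) = (\<Sum>j\<in>{0..<?m}. W $$ (?a, j) * ?U $$ (?b, j))"
      if "W \<in> carrier_mat ?m ?m" for W
      using abm Uc[OF w] that by (simp add: scalar_prod_def)
    have "B i \<omega> $$ (?a, ?b) = \<tau> * (?U * proj_mat ?m ?k * transpose_mat ?U) $$ (?a, ?b)"
      unfolding B_eq using abm Uc[OF w] pc by (intro index_smult_mat) auto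
    also have "\<dots> = \<tau> * (\<Sum>j\<in>{0..<?m}. (?U * proj_mat ?m ?k) $$ (?a, j) * ?U $$ (?b, j))"
      using Uc[OF w] pc by (subst entry) auto
    also have "(\<Sum>j\<in>{0..<?m}. (?U * proj_mat ?m ?k) $$ (?a, j) * ?U $$ (?b, j)) =
        (\<Sum>j\<in>{0..<?k}. ?U $$ (?a, j) * ?U $$ (?b, j))"
      using K_less[of i] by (intro sum.mono_neutral_cong_right) (auto simp: UP)
    finally have "BS i \<omega> $$ (a, b) = \<tau> * (\<Sum>j\<in>{0..<?k}. ?U $$ (?a, j) * ?U $$ (?b, j))"
      using ab by (simp add: BS_eq)
    moreover have "((\<tau> / real ?m) \<cdot>\<^sub>m (transpose_mat (X i \<omega>) * X i \<omega>)) $$ (a, b) =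
        \<tau> / real ?m * (\<Sum>j\<in>{0..<?k}. X i \<omega> $$ (j, a) * X i \<omega> $$ (j, b))"
      using ab Xc[of \<omega>] by (simp add: scalar_prod_def)
    moreover have "(\<Sum>j\<in>{0..<?k}. X i \<omega> $$ (j, a) * X i \<omega> $$ (j, b)) =
        real ?m * (\<Sum>j\<in>{0..<?k}. ?U $$ (?a, j) * ?U $$ (?b, j))"
    proof -
      have sq: "sqrt ?m * x * (sqrt ?m * y) = real ?m * (x * y)" for x y :: real
        using mpos by (simp add: mult_ac flip: mult.assoc[of "sqrt (real ?m)" "sqrt (real ?m)"])
      show ?thesis
        unfolding sum_distrib_left
      proof (rule sum.cong[OF refl])
        fix j assume "j \<in> {0..<?k}"
        then have "X i \<omega> $$ (j, a) = sqrt ?m * ?U $$ (?a, j)" "X i \<omega> $$ (j, b) = sqrt ?m * ?U $$ (?b, j)"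
          using ab Xe by auto
        then show "X i \<omega> $$ (j, a) * X i \<omega> $$ (j, b) = real ?m * (?U $$ (?a, j) * ?U $$ (?b, j))"
          by (simp only: sq)
      qed
    qed
    ultimately show "BS i \<omega> $$ (a, b) = ((\<tau> / real ?m) \<cdot>\<^sub>m (transpose_mat (X i \<omega>) * X i \<omega>)) $$ (a, b)"
      using mpos by simp
  qed (use Xc[of \<omega>] in \<open>auto simp: BS_eq\<close>)
  have Xm: "X i \<in> P i \<rightarrow>\<^sub>M mat_borel ?k ?N"
  proof (rule measurable_mat_borelI)
    fix j a assume ja: "j < ?k" "a < ?N"
    let ?T = "{s. s \<subseteq> {..<?m} \<and> card s = ?N}"
    have fin: "finite ?T" by simp
    have Ue: "(\<lambda>\<omega>. U i \<omega> $$ (x, j)) \<in> borel_measurable (P i)" if "x < ?m" for x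
    proof -
      have "(\<lambda>A. A $$ (x, j)) \<in> borel_measurable (orth_borel ?m)"
        unfolding orth_borel_def using that ja K_less[of i]
        by (intro measurable_restrict_space1 mat_borel_entry) auto
      then show ?thesis by (rule measurable_compose[OF U_meas])
    qed
    have Sind: "(\<lambda>\<omega>. indicator {s} (S i \<omega>) :: real) \<in> borel_measurable (P i)" for s
      by (rule measurable_compose[OF S_meas]) simp
    \<comment> \<open>The index set is random, but takes finitely many values.\<close>
    have "(\<lambda>\<omega>. \<Sum>s\<in>?T. indicator {s} (S i \<omega>) * (sqrt ?m * U i \<omega> $$ (enum i s a, j))) \<in> borel_measurable (P i)"
      using ja en by (intro borel_measurable_sum borel_measurable_times borel_measurable_const Sind Ue) auto
    then show "(\<lambda>\<omega>. X i \<omega> $$ (j, a)) \<in> borel_measurable (P i)"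
    proof (rule measurable_cong[THEN iffD1, rotated])
      fix \<omega> assume w: "\<omega> \<in> space (P i)"
      have "(\<Sum>s\<in>?T. indicator {s} (S i \<omega>) * (sqrt ?m * U i \<omega> $$ (enum i s a, j))) =
          (\<Sum>s\<in>?T. if s = S i \<omega> then sqrt ?m * U i \<omega> $$ (enum i (S i \<omega>) a, j) else 0)"
        by (intro sum.cong) auto
      also have "\<dots> = X i \<omega> $$ (j, a)" using Sc[OF w] ja by (simp add: Xe)
      finally show "(\<Sum>s\<in>?T. indicator {s} (S i \<omega>) * (sqrt ?m * U i \<omega> $$ (enum i s a, j))) = X i \<omega> $$ (j, a)" .
    qed
  qed (rule Xc)
  fix \<epsilon> :: real assume e: "0 \<le> \<epsilon>"
  let ?c = "(\<tau> / real ?m) ^ n i" and ?\<sigma> = "\<sigma>_haf ?k (n i)"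
  have cpos: "0 < ?c" using tpos mpos by simp
  show "(SUP z. measure (P i) {\<omega> \<in> space (P i). \<bar>haf (BS i \<omega>) - z\<bar> \<le> \<epsilon> * ?c * ?\<sigma>})
      \<le> min 1 (B_real ?k (n i) * \<epsilon>) + \<delta> i"
  proof (rule cSUP_least)
    fix z :: real
    let ?A = "{A \<in> carrier_mat ?k ?N. \<bar>haf (transpose_mat A * A) - z / ?c\<bar> \<le> \<epsilon> * ?\<sigma>}"
    have "{A \<in> space (mat_borel ?k ?N). \<bar>haf (transpose_mat A * A) - z / ?c\<bar> \<le> \<epsilon> * ?\<sigma>} \<in> sets (mat_borel ?k ?N)"
      using haf_gram_measurable[of ?k ?N] by measurable
    then have A: "?A \<in> sets (mat_borel ?k ?N)" by simp
    have "{\<omega> \<in> space (P i). \<bar>haf (BS i \<omega>) - z\<bar> \<le> \<epsilon> * ?c * ?\<sigma>} = X i -` ?A \<inter> space (P i)"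
    proof -
      have "\<bar>haf (BS i \<omega>) - z\<bar> \<le> \<epsilon> * ?c * ?\<sigma> \<longleftrightarrow> \<bar>haf (transpose_mat (X i \<omega>) * X i \<omega>) - z / ?c\<bar> \<le> \<epsilon> * ?\<sigma>"
        if w: "\<omega> \<in> space (P i)" for \<omega>
      proof -
        let ?h = "haf (transpose_mat (X i \<omega>) * X i \<omega>)"
        have "haf (BS i \<omega>) = ?c * ?h"
          unfolding BX[OF w] using Xc[of \<omega>] N_eq[of i] by (intro haf_smult) auto
        moreover have "\<bar>c * h - z\<bar> = c * \<bar>h - z / c\<bar>" if "0 < c" for c h :: real
        proof -
          have "c * h - z = c * (h - z / c)" using that by (simp add: right_diff_distrib)
          then show ?thesis using that by (simp only: abs_mult abs_of_pos)
        qed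
        ultimately have "\<bar>haf (BS i \<omega>) - z\<bar> = ?c * \<bar>?h - z / ?c\<bar>" using cpos by (simp only:)
        moreover have "\<epsilon> * ?c * ?\<sigma> = ?c * (\<epsilon> * ?\<sigma>)" by simp
        ultimately show ?thesis using cpos by (simp only: mult_le_cancel_left_pos)
      qed
      then show ?thesis using Xc by auto
    qed
    then have "measure (P i) {\<omega> \<in> space (P i). \<bar>haf (BS i \<omega>) - z\<bar> \<le> \<epsilon> * ?c * ?\<sigma>} =
        measure (distr (P i) (mat_borel ?k ?N) (X i)) ?A"
      by (simp add: measure_distr[OF Xm A])
    also have "\<dots> \<le> measure (gauss_mat ?k ?N) ?A + \<delta> i"
      unfolding \<delta>_eq using A
      by (intro measure_le_tv_dist P.prob_space_distr[OF Xm] prob_space_gauss_mat) simp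
    also have "measure (gauss_mat ?k ?N) ?A \<le> min 1 (B_real ?k (n i) * \<epsilon>)"
      unfolding N_eq by (rule gauss_mat_small_ball[OF n_ge K_ge e])
    finally show "measure (P i) {\<omega> \<in> space (P i). \<bar>haf (BS i \<omega>) - z\<bar> \<le> \<epsilon> * ?c * ?\<sigma>}
        \<le> min 1 (B_real ?k (n i) * \<epsilon>) + \<delta> i" by simp
  qed simp
qed

end
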